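(* If a $k$-problem $\Pi$ admits a reduce routine with size bound $\mathsf s$ and run time bound $\mathsf f$, then there exists an algorithm that, given a $k$-weighted graph $G$ on $n$ vertices and a rooted layout $\mathcal L$ of $G$, computes in time $$O\big(2^{2k}k\cdot \mathsf s(G,\mathcal L)^2\cdot(\mathsf f(G,\mathcal L)\cdot n+n^2)+n^3\big)$$ a set that has size at most $\mathsf s(G,\mathcal L)$ and contains an optimal solution to $\Pi$ on $G$ if $\Pi$ has a solution on $G$.
   Context: Graphs are finite and simple; $n=|V(G)|$; $\overline A=V(G)\setminus A$; $\mathcal P(A)^k$ is the set of $k$-tuples of subsets of $A$; for tuples, $\mathbb B\cup\mathbb D$ is the coordinatewise union. A $k$-weighted graph is a graph $G$ with integer weights $w(v,S)$ for $v\in V(G)$, $S\subseteq[k]$; $\mathrm{obj}_G(\mathbb B)=\sum_{v\in V(G)}w(v,\{i:v\in B_i\})$ for $\mathbb B=(B_1,\dots,B_k)$. A $k$-problem $\Pi$ associates with every $k$-weighted graph $G$ a set of solutions $\Pi(G)\subseteq\mathcal P(V(G))^k$; an optimal solution is $\mathbb B^*\in\Pi(G)$ with $\mathrm{obj}_G(\mathbb B^* )=\max\{\mathrm{obj}_G(\mathbb B):\mathbb B\in\Pi(G)\}$. For $A\subseteq V(G)$, $\mathcal B\subseteq\mathcal P(A)^k$ and $\mathbb D\in\mathcal P(\overline A)^k$, $\mathrm{best}(\mathcal B,\mathbb D)=\max\{\mathrm{obj}_G(\mathbb B):\mathbb B\in\mathcal B,\ \mathbb B\cup\mathbb D\in\Pi(G)\}$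 (with $\max\emptyset=-\infty$). $\mathcal B_1$ represents $\mathcal B_2$ over $A$ if $\mathrm{best}(\mathcal B_1,\mathbb D)=\mathrm{best}(\mathcal B_2,\mathbb D)$ for every $\mathbb D\in\mathcal P(\overline A)^k$. A reduce routine for $\Pi$ is a subroutine that takes as input a $k$-weighted graph $G$ with its distance matrix, a set $A\subseteq V(G)$ and $\mathcal B\subseteq\mathcal P(A)^k$, and returns a subset $\mathrm{reduce}(\mathcal B)\subseteq\mathcal B$ that represents $\mathcal B$ over $A$. A function $\mathsf s(G,A)$ is a size bound if always $|\mathrm{reduce}(\mathcal B)|\le\mathsf s(G,A)$; a function $\mathsf f(G,A)$ is a run time bound if the routine always runs in time at most $\mathsf f(G,A)\cdot|\mathcal B|$. A rooted layout $\mathcal L=(T,\delta)$ of $G$: $T$ a rooted binary tree, $\delta$ a bijection from $V(G)$ to the leaves of $T$; $V_x$ is the set of vertices mapped to leaves below node $x$ (inclusive). $\mathsf s(G,\mathcal L)=\max_{x\in V(T)}\mathsf s(G,V_x)$ and $\mathsf f(G,\mathcal L)=\max_{x\in V(T)}\mathsf f(G,V_x)$.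
   Formalization: Assumes k ≥ 1 and that the size bound s is always at least 1 (with s(G,L)=0 the claimed O(n^3) time would leave no time to call reduce, and the claim fails); the run time bound f·|B| is required only for nonempty B. *)

theory Defs
  imports Complex_Main "HOL-Library.FuncSet" "HOL-Library.Extended_Nat" "HOL-Library.Extended_Real"
begin

section \<open>Machine model\<close>

text \<open>
  Algorithms are programs for a unit-cost random access machine.  A program is a finite list of
  procedures.  Each invocation of a procedure owns an unbounded array of registers (all initially
  \<open>Num 0\<close>, the argument in register 0) with indirect addressing, and hands back the contents of
  register 0.  A register holds an integer or a pointer to an immutable pair; pairs serve to pass
  structured data between procedures.  Additions, subtractions, comparisons, register accesses and
  pair operations cost one step each (there is no multiplication, so unit cost is innocuous), and
  the cost of a call contains the cost of executing the called body.
  Operations applied to a value of the wrong kind treat it as \<open>Num 0\<close>; a call to a non-existing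
  procedure has no execution.
\<close>

datatype val = Num int | Pair val val

datatype exp =
    Lit int
  | Reg exp
  | Plus exp exp
  | Minus exp exp
  | Less exp exp
  | IsPair exp
  | MkPair exp exp
  | Fst exp
  | Snd exp

datatype com =
    Skip
  | Assign exp exp
  | Seq com com
  | If exp com com
  | While exp com
  | Call exp nat exp

type_synonym regs = "int \<Rightarrow> val"

fun num_of :: "val \<Rightarrow> int" where
  "num_of (Num i) = i"
| "num_of (Pair _ _) = 0"

fun eval_exp :: "exp \<Rightarrow> regs \<Rightarrow> val" where
  "eval_exp (Lit i) \<sigma> = Num i"
| "eval_exp (Reg e) \<sigma> = \<sigma> (num_of (eval_exp e \<sigma>))"
| "eval_exp (Plus a b) \<sigma> = Num (num_of (eval_exp a \<sigma>) + num_of (eval_exp b \<sigma>))"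
| "eval_exp (Minus a b) \<sigma> = Num (num_of (eval_exp a \<sigma>) - num_of (eval_exp b \<sigma>))"
| "eval_exp (Less a b) \<sigma> = Num (if num_of (eval_exp a \<sigma>) < num_of (eval_exp b \<sigma>) then 1 else 0)"
| "eval_exp (IsPair e) \<sigma> = (case eval_exp e \<sigma> of Num _ \<Rightarrow> Num 0 | Pair _ _ \<Rightarrow> Num 1)"
| "eval_exp (MkPair a b) \<sigma> = Pair (eval_exp a \<sigma>) (eval_exp b \<sigma>)"
| "eval_exp (Fst e) \<sigma> = (case eval_exp e \<sigma> of Num _ \<Rightarrow> Num 0 | Pair x _ \<Rightarrow> x)"
| "eval_exp (Snd e) \<sigma> = (case eval_exp e \<sigma> of Num _ \<Rightarrow> Num 0 | Pair _ y \<Rightarrow> y)"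

fun exp_cost :: "exp \<Rightarrow> nat" where
  "exp_cost (Lit i) = 1"
| "exp_cost (Reg e) = 1 + exp_cost e"
| "exp_cost (Plus a b) = 1 + exp_cost a + exp_cost b"
| "exp_cost (Minus a b) = 1 + exp_cost a + exp_cost b"
| "exp_cost (Less a b) = 1 + exp_cost a + exp_cost b"
| "exp_cost (IsPair e) = 1 + exp_cost e"
| "exp_cost (MkPair a b) = 1 + exp_cost a + exp_cost b"
| "exp_cost (Fst e) = 1 + exp_cost e"
| "exp_cost (Snd e) = 1 + exp_cost e"

definition init_regs :: "val \<Rightarrow> regs" where
  "init_regs v = (\<lambda>_. Num 0)(0 := v)"

inductive exec :: "com list \<Rightarrow> com \<Rightarrow> regs \<Rightarrow> nat \<Rightarrow> regs \<Rightarrow> bool" for procs :: "com list" where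
  Skip: "exec procs Skip \<sigma> 1 \<sigma>"
| Assign: "exec procs (Assign a e) \<sigma> (1 + exp_cost a + exp_cost e)
     (\<sigma>(num_of (eval_exp a \<sigma>) := eval_exp e \<sigma>))"
| Seq: "exec procs c1 \<sigma> t1 \<sigma>1 \<Longrightarrow> exec procs c2 \<sigma>1 t2 \<sigma>2 \<Longrightarrow>
     exec procs (Seq c1 c2) \<sigma> (1 + t1 + t2) \<sigma>2"
| IfTrue: "eval_exp b \<sigma> \<noteq> Num 0 \<Longrightarrow> exec procs c1 \<sigma> t \<sigma>1 \<Longrightarrow>
     exec procs (If b c1 c2) \<sigma> (1 + exp_cost b + t) \<sigma>1"
| IfFalse: "eval_exp b \<sigma> = Num 0 \<Longrightarrow> exec procs c2 \<sigma> t \<sigma>1 \<Longrightarrow>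
     exec procs (If b c1 c2) \<sigma> (1 + exp_cost b + t) \<sigma>1"
| WhileTrue: "eval_exp b \<sigma> \<noteq> Num 0 \<Longrightarrow> exec procs c \<sigma> t1 \<sigma>1 \<Longrightarrow>
     exec procs (While b c) \<sigma>1 t2 \<sigma>2 \<Longrightarrow>
     exec procs (While b c) \<sigma> (1 + exp_cost b + t1 + t2) \<sigma>2"
| WhileFalse: "eval_exp b \<sigma> = Num 0 \<Longrightarrow> exec procs (While b c) \<sigma> (1 + exp_cost b) \<sigma>"
| Call: "p < length procs \<Longrightarrow> exec procs (procs ! p) (init_regs (eval_exp e \<sigma>)) t \<sigma>1 \<Longrightarrow>
     exec procs (Call a p e) \<sigma> (1 + exp_cost a + exp_cost e + t)
       (\<sigma>(num_of (eval_exp a \<sigma>) := \<sigma>1 0))"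

text \<open>The second component of a program is the index of its main procedure.\<close>

type_synonym program = "com list \<times> nat"

definition runs :: "program \<Rightarrow> val \<Rightarrow> val \<Rightarrow> nat \<Rightarrow> bool" where
  "runs P inp out t \<longleftrightarrow> snd P < length (fst P) \<and>
     (\<exists>\<sigma>. exec (fst P) (fst P ! snd P) (init_regs inp) t \<sigma> \<and> \<sigma> 0 = out)"

lemma exec_deterministic:
  "exec procs c \<sigma> t \<sigma>1 \<Longrightarrow> exec procs c \<sigma> t' \<sigma>1' \<Longrightarrow> t = t' \<and> \<sigma>1 = \<sigma>1'"
proof (induction arbitrary: t' \<sigma>1' rule: exec.induct)
  case (Seq c1 \<sigma> t1 \<sigma>1 c2 t2 \<sigma>2)
  from Seq.prems show ?case
    by (cases rule: exec.cases) (use Seq.IH in blast)+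
next
  case (WhileTrue b \<sigma> c t1 \<sigma>1 t2 \<sigma>2)
  from WhileTrue.prems show ?case
    by (cases rule: exec.cases) (use WhileTrue.IH WhileTrue.hyps in blast)+
qed (erule exec.cases; fastforce)+

lemma runs_deterministic: "runs P i v t \<Longrightarrow> runs P i v' t' \<Longrightarrow> v = v' \<and> t = t'"
  unfolding runs_def using exec_deterministic by blast

section \<open>Weighted graphs and problems\<close>

text \<open>
  The vertices of a graph with \<open>order G = n\<close> are \<open>0, \<dots>, n - 1\<close>, and the index set \<open>[k]\<close> is
  \<open>{..<k}\<close>.  A \<open>k\<close>-tuple of sets is a list of length \<open>k\<close>.
\<close>

record wgraph =
  order :: nat
  edges :: "nat set set"
  weight :: "nat \<times> nat set \<Rightarrow> int"

definition verts :: "wgraph \<Rightarrow> nat set" where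
  "verts G = {..<order G}"

definition weighted_graph :: "nat \<Rightarrow> wgraph \<Rightarrow> bool" where
  "weighted_graph k G \<longleftrightarrow>
     edges G \<subseteq> {e. e \<subseteq> verts G \<and> card e = 2} \<and>
     weight G \<in> extensional (verts G \<times> Pow {..<k})"

definition adj_rel :: "wgraph \<Rightarrow> (nat \<times> nat) set" where
  "adj_rel G = {(u, v). {u, v} \<in> edges G}"

definition gdist :: "wgraph \<Rightarrow> nat \<Rightarrow> nat \<Rightarrow> enat" where
  "gdist G u v = (INF m \<in> {m. (u, v) \<in> adj_rel G ^^ m}. enat m)"

definition tuples :: "nat \<Rightarrow> nat set \<Rightarrow> nat set list set" where
  "tuples k A = {B. length B = k \<and> set B \<subseteq> Pow A}"

definition tuple_union :: "nat set list \<Rightarrow> nat set list \<Rightarrow> nat set list" where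
  "tuple_union B D = map2 (\<union>) B D"

definition obj :: "wgraph \<Rightarrow> nat set list \<Rightarrow> int" where
  "obj G B = (\<Sum>v \<in> verts G. weight G (v, {i. i < length B \<and> v \<in> B ! i}))"

type_synonym problem = "wgraph \<Rightarrow> nat set list set"

definition k_problem :: "nat \<Rightarrow> problem \<Rightarrow> bool" where
  "k_problem k \<P> \<longleftrightarrow> (\<forall>G. weighted_graph k G \<longrightarrow> \<P> G \<subseteq> tuples k (verts G))"

definition optimal_solution :: "problem \<Rightarrow> wgraph \<Rightarrow> nat set list \<Rightarrow> bool" where
  "optimal_solution \<P> G B \<longleftrightarrow> B \<in> \<P> G \<and> obj G B = Max (obj G ` \<P> G)"

definition best :: "problem \<Rightarrow> wgraph \<Rightarrow> nat set list set \<Rightarrow> nat set list \<Rightarrow> ereal" where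
  "best \<P> G \<B> D =
     (let M = obj G ` {B \<in> \<B>. tuple_union B D \<in> \<P> G}
      in if M = {} then -\<infinity> else ereal (real_of_int (Max M)))"

definition represents ::
  "nat \<Rightarrow> problem \<Rightarrow> wgraph \<Rightarrow> nat set \<Rightarrow> nat set list set \<Rightarrow> nat set list set \<Rightarrow> bool" where
  "represents k \<P> G A \<B>1 \<B>2 \<longleftrightarrow>
     (\<forall>D \<in> tuples k (verts G - A). best \<P> G \<B>1 D = best \<P> G \<B>2 D)"

section \<open>Rooted layouts\<close>

text \<open>
  Internal nodes have exactly two children.  The bijection \<open>\<delta>\<close> is given by labelling each leaf with
  the vertex mapped to it.
\<close>

datatype layout = Leaf nat | Node layout layout

fun leaves :: "layout \<Rightarrow> nat list" where
  "leaves (Leaf v) = [v]"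
| "leaves (Node l r) = leaves l @ leaves r"

fun subtrees :: "layout \<Rightarrow> layout set" where
  "subtrees (Leaf v) = {Leaf v}"
| "subtrees (Node l r) = insert (Node l r) (subtrees l \<union> subtrees r)"

definition rooted_layout :: "wgraph \<Rightarrow> layout \<Rightarrow> bool" where
  "rooted_layout G L \<longleftrightarrow> distinct (leaves L) \<and> set (leaves L) = verts G"

definition layout_max :: "(wgraph \<Rightarrow> nat set \<Rightarrow> real) \<Rightarrow> wgraph \<Rightarrow> layout \<Rightarrow> real" where
  "layout_max g G L = Max ((\<lambda>x. g G (set (leaves x))) ` subtrees L)"

section \<open>Encoding of inputs and outputs\<close>

text \<open>
  Lists are chains of pairs ending in \<open>Num 0\<close>; sets of vertices are incidence vectors of length \<open>n\<close>;
  a family of tuples is the list of its members, without repetition and in arbitrary order; infinite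
  distance is \<open>-1\<close>; the weights of a vertex are listed by the binary code of the subset of \<open>[k]\<close>.
\<close>

definition enc_list :: "('a \<Rightarrow> val) \<Rightarrow> 'a list \<Rightarrow> val" where
  "enc_list g xs = foldr (\<lambda>x r. Pair (g x) r) xs (Num 0)"

definition enc_bool :: "bool \<Rightarrow> val" where
  "enc_bool b = Num (if b then 1 else 0)"

definition enc_set :: "nat \<Rightarrow> nat set \<Rightarrow> val" where
  "enc_set n A = enc_list (\<lambda>v. enc_bool (v \<in> A)) [0..<n]"

definition enc_family :: "nat \<Rightarrow> nat set list list \<Rightarrow> val" where
  "enc_family n Bs = enc_list (enc_list (enc_set n)) Bs"

definition enc_enat :: "enat \<Rightarrow> val" where
  "enc_enat d = (case d of enat m \<Rightarrow> Num (int m) | \<infinity> \<Rightarrow> Num (-1))"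

definition enc_matrix :: "nat \<Rightarrow> (nat \<Rightarrow> nat \<Rightarrow> val) \<Rightarrow> val" where
  "enc_matrix n a = enc_list (\<lambda>u. enc_list (\<lambda>v. a u v) [0..<n]) [0..<n]"

definition enc_graph :: "nat \<Rightarrow> wgraph \<Rightarrow> val" where
  "enc_graph k G =
     Pair (Num (int (order G)))
    (Pair (Num (int k))
    (Pair (enc_matrix (order G) (\<lambda>u v. enc_bool ({u, v} \<in> edges G)))
          (enc_list (\<lambda>v. enc_list (\<lambda>m. Num (weight G (v, {i. bit m i}))) [0..<2 ^ k]) [0..<order G])))"

fun enc_layout :: "layout \<Rightarrow> val" where
  "enc_layout (Leaf v) = Num (int v)"
| "enc_layout (Node l r) = Pair (enc_layout l) (enc_layout r)"

definition reduce_input :: "nat \<Rightarrow> wgraph \<Rightarrow> nat set \<Rightarrow> nat set list list \<Rightarrow> val" where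
  "reduce_input k G A Bs =
     Pair (enc_graph k G)
    (Pair (enc_matrix (order G) (\<lambda>u v. enc_enat (gdist G u v)))
    (Pair (enc_set (order G) A) (enc_family (order G) Bs)))"

definition algorithm_input :: "nat \<Rightarrow> wgraph \<Rightarrow> layout \<Rightarrow> val" where
  "algorithm_input k G L = Pair (enc_graph k G) (enc_layout L)"

section \<open>Reduce routines\<close>

definition reduce_instance :: "nat \<Rightarrow> wgraph \<Rightarrow> nat set \<Rightarrow> nat set list list \<Rightarrow> bool" where
  "reduce_instance k G A Bs \<longleftrightarrow>
     weighted_graph k G \<and> A \<subseteq> verts G \<and> distinct Bs \<and> set Bs \<subseteq> tuples k A"

definition reduce_routine :: "nat \<Rightarrow> problem \<Rightarrow> program \<Rightarrow> bool" where
  "reduce_routine k \<P> R \<longleftrightarrow>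
     (\<forall>G A Bs. reduce_instance k G A Bs \<longrightarrow>
       (\<exists>Cs t. runs R (reduce_input k G A Bs) (enc_family (order G) Cs) t \<and>
          distinct Cs \<and> set Cs \<subseteq> set Bs \<and> represents k \<P> G A (set Cs) (set Bs)))"

text \<open>
  Size bounds take values at least 1: with value 0 allowed, the time bound \<open>O(n^3)\<close> claimed
  for a layout with \<open>s(G,L) = 0\<close> would leave no time for a single call of the routine.
\<close>

definition size_bound :: "nat \<Rightarrow> program \<Rightarrow> (wgraph \<Rightarrow> nat set \<Rightarrow> real) \<Rightarrow> bool" where
  "size_bound k R s \<longleftrightarrow>
     (\<forall>G A. weighted_graph k G \<and> A \<subseteq> verts G \<longrightarrow> 1 \<le> s G A) \<and>
     (\<forall>G A Bs Cs t. reduce_instance k G A Bs \<and>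
        runs R (reduce_input k G A Bs) (enc_family (order G) Cs) t \<longrightarrow> real (length Cs) \<le> s G A)"

text \<open>
  The empty family is exempt, since every run takes at least one step.
\<close>

definition run_time_bound :: "nat \<Rightarrow> program \<Rightarrow> (wgraph \<Rightarrow> nat set \<Rightarrow> real) \<Rightarrow> bool" where
  "run_time_bound k R f \<longleftrightarrow>
     (\<forall>G A Bs v t. reduce_instance k G A Bs \<and> Bs \<noteq> [] \<and>
        runs R (reduce_input k G A Bs) v t \<longrightarrow> real t \<le> f G A * real (length Bs))"

end

theory Submission
  imports Defs
begin

text \<open>
  Process the layout bottom-up. At a leaf \<open>v\<close> start from all \<open>2^k\<close> tuples over \<open>{v}\<close>; at an internal
  node start from all unions of a tuple kept at the left child with one kept at the right child;
  in both cases pass the family to the reduce routine. Weights of disjoint tuples add up, so the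
  exchange argument (first replace the left part, then the right part) shows that the unions of two
  representing families represent all tuples over the union of the two vertex sets; at the root this
  yields an optimal solution. A node costs \<open>O(k n s^2 + 2^k (n + f) + f s^2)\<close>, and the distance matrix
  costs \<open>O(n^3)\<close> by Floyd--Warshall. All procedures are recursive, and the procedures of the reduce
  routine come first in the program so that their call indices remain valid.
\<close>

section \<open>Running time calculus\<close>

text \<open>The routine is known only through its runs on valid inputs, and this shapes the
  invariant. Every family handed to it must be certified free of repetitions and contained in the
  tuples over V_x; injectivity of the union on disjoint parts gives this without any deduplication.
  What a node keeps is compared with all tuples over V_x rather than with the candidates formed
  there, so the guarantees of the children combine regardless of how they were obtained. The program
  never sees the bounds \<open>s\<close> and \<open>f\<close>. They enter the analysis alone,
  rounded to naturals \<open>S\<close> and \<open>F\<close> that serve all nodes at once. Since each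
  call owns fresh registers, recursion leaves only straight-line code and calls to reason about:
  \<open>wp\<close> carries the cost through a body, \<open>calls\<close> keeps just an upper bound.
  Additive constants such as 50 are allowances for the code of one activation, generous enough for
  the inductions to close by simple arithmetic.\<close>

definition wp :: "com list \<Rightarrow> com \<Rightarrow> regs \<Rightarrow> (regs \<Rightarrow> nat \<Rightarrow> bool) \<Rightarrow> bool" where
  "wp \<Gamma> c \<sigma> Q \<longleftrightarrow> (\<exists>t \<sigma>'. exec \<Gamma> c \<sigma> t \<sigma>' \<and> Q \<sigma>' t)"

definition calls :: "com list \<Rightarrow> nat \<Rightarrow> val \<Rightarrow> val \<Rightarrow> nat \<Rightarrow> bool" where
  "calls \<Gamma> p v w T \<longleftrightarrow> (\<exists>t \<le> T. runs (\<Gamma>, p) v w t)"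

definition proc_at :: "com list \<Rightarrow> nat \<Rightarrow> com \<Rightarrow> bool" where
  "proc_at \<Gamma> p c \<longleftrightarrow> p < length \<Gamma> \<and> \<Gamma> ! p = c"

lemma wp_Skip: "Q \<sigma> 1 \<Longrightarrow> wp \<Gamma> Skip \<sigma> Q"
  unfolding wp_def by (blast intro: exec.Skip)

lemma wp_Assign:
  "Q (\<sigma>(num_of (eval_exp a \<sigma>) := eval_exp e \<sigma>)) (1 + exp_cost a + exp_cost e) \<Longrightarrow>
   wp \<Gamma> (Assign a e) \<sigma> Q"
  unfolding wp_def by (blast intro: exec.Assign)

lemma wp_Seq:
  "wp \<Gamma> c1 \<sigma> (\<lambda>\<sigma>1 t1. wp \<Gamma> c2 \<sigma>1 (\<lambda>\<sigma>2 t2. Q \<sigma>2 (1 + t1 + t2))) \<Longrightarrow> wp \<Gamma> (Seq c1 c2) \<sigma> Q"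
  unfolding wp_def by (blast intro: exec.Seq)

lemma wp_If:
  assumes "eval_exp b \<sigma> \<noteq> Num 0 \<Longrightarrow> wp \<Gamma> c1 \<sigma> (\<lambda>\<sigma>1 t. Q \<sigma>1 (1 + exp_cost b + t))"
    and "eval_exp b \<sigma> = Num 0 \<Longrightarrow> wp \<Gamma> c2 \<sigma> (\<lambda>\<sigma>1 t. Q \<sigma>1 (1 + exp_cost b + t))"
  shows "wp \<Gamma> (If b c1 c2) \<sigma> Q"
  using assms unfolding wp_def by (cases "eval_exp b \<sigma> = Num 0") (blast intro: exec.IfTrue exec.IfFalse)+

lemma wp_Call:
  assumes "calls \<Gamma> p v w T" and "eval_exp e \<sigma> = v"
    and "\<And>t. t \<le> T \<Longrightarrow> Q (\<sigma>(num_of (eval_exp a \<sigma>) := w)) (1 + exp_cost a + exp_cost e + t)"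
  shows "wp \<Gamma> (Call a p e) \<sigma> Q"
  using assms unfolding wp_def calls_def runs_def fst_conv snd_conv
  by (blast intro: exec.Call)

lemmas wp_intros = wp_Skip wp_Assign wp_Seq wp_If

lemma callsI:
  assumes "proc_at \<Gamma> p c" and "wp \<Gamma> c (init_regs v) (\<lambda>\<sigma> t. \<sigma> 0 = w \<and> t \<le> T)"
  shows "calls \<Gamma> p v w T"
  using assms unfolding calls_def runs_def wp_def proc_at_def by auto

lemma calls_mono: "calls \<Gamma> p v w T \<Longrightarrow> T \<le> T' \<Longrightarrow> calls \<Gamma> p v w T'"
  unfolding calls_def by (meson order_trans)

text \<open>A call outside the program has no execution, so every index met in a run of
  \<open>\<Gamma>\<close> lies below its length and denotes the same body after appending.\<close>

lemma exec_append: "exec \<Gamma> c \<sigma> t \<sigma>' \<Longrightarrow> exec (\<Gamma> @ \<Delta>) c \<sigma> t \<sigma>'"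
proof (induction rule: exec.induct)
  case (Call p e \<sigma> t \<sigma>1 a)
  then have "exec (\<Gamma> @ \<Delta>) ((\<Gamma> @ \<Delta>) ! p) (init_regs (eval_exp e \<sigma>)) t \<sigma>1"
    by (simp add: nth_append)
  with Call.hyps show ?case
    by (intro exec.Call) auto
qed (blast intro: exec.intros)+

lemma calls_of_runs: "runs R v w t \<Longrightarrow> t \<le> T \<Longrightarrow> calls (fst R @ \<Delta>) (snd R) v w T"
  unfolding calls_def runs_def by (auto simp: nth_append intro: exec_append)

section \<open>Procedures on lists\<close>

lemma enc_list_simps [simp]:
  "enc_list g [] = Num 0"
  "enc_list g (x # xs) = Pair (g x) (enc_list g xs)"
  by (simp_all add: enc_list_def)

lemma enc_list_map: "enc_list g (map h xs) = enc_list (\<lambda>x. g (h x)) xs"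
  by (induction xs) auto

abbreviation reg :: "int \<Rightarrow> exp" where "reg i \<equiv> Reg (Lit i)"

abbreviation (input) mk_triple :: "exp \<Rightarrow> exp \<Rightarrow> exp \<Rightarrow> exp" where
  "mk_triple a b c \<equiv> MkPair a (MkPair b c)"

text \<open>The procedures built from the next three bodies expect \<open>(e, (b, xs))\<close> and call \<open>q\<close> on
  \<open>(e, (b', x))\<close> for each entry \<open>x\<close> of \<open>xs\<close>, where \<open>b'\<close> is \<open>b\<close> itself, a counter starting at \<open>b\<close>,
  or the corresponding entry of \<open>b\<close>.\<close>

definition map_body :: "nat \<Rightarrow> nat \<Rightarrow> com" where
  "map_body p q = If (IsPair (Snd (Snd (reg 0))))
     (Seq (Call (Lit 1) p (mk_triple (Fst (reg 0)) (Fst (Snd (reg 0))) (Snd (Snd (Snd (reg 0))))))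
     (Seq (Call (Lit 2) q (mk_triple (Fst (reg 0)) (Fst (Snd (reg 0))) (Fst (Snd (Snd (reg 0))))))
          (Assign (Lit 0) (MkPair (reg 2) (reg 1)))))
     (Assign (Lit 0) (Lit 0))"

text \<open>Each entry is charged the bound of the callee plus 50, which covers the test, both
  argument triples and the final pair; the summand 1 pays for the call on the empty tail.\<close>

lemma calls_map:
  assumes p: "proc_at \<Gamma> p (map_body p q)"
    and q: "\<And>x. x \<in> set xs \<Longrightarrow> calls \<Gamma> q (Pair e (Pair b (g x))) (r x) T"
  shows "calls \<Gamma> p (Pair e (Pair b (enc_list g xs))) (enc_list r xs) ((T + 50) * (length xs + 1))"
  using q
proof (induction xs)
  case Nil
  show ?case
    by (rule callsI[OF p], unfold map_body_def, intro wp_intros)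
       (auto simp: init_regs_def)
next
  case (Cons x xs)
  note ih = Cons.IH[OF Cons.prems] and hd = Cons.prems[of x]
  show ?case
    by (rule callsI[OF p], unfold map_body_def, intro wp_intros wp_Call[OF ih] wp_Call[OF hd])
       (auto simp: init_regs_def algebra_simps)
qed

definition mapi_body :: "nat \<Rightarrow> nat \<Rightarrow> com" where
  "mapi_body p q = If (IsPair (Snd (Snd (reg 0))))
     (Seq (Call (Lit 1) p (mk_triple (Fst (reg 0)) (Plus (Fst (Snd (reg 0))) (Lit 1)) (Snd (Snd (Snd (reg 0))))))
     (Seq (Call (Lit 2) q (mk_triple (Fst (reg 0)) (Fst (Snd (reg 0))) (Fst (Snd (Snd (reg 0))))))
          (Assign (Lit 0) (MkPair (reg 2) (reg 1)))))
     (Assign (Lit 0) (Lit 0))"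

text \<open>The start \<open>i\<close> is arbitrary because the tail of an interval starts one step
  later; indexing by intervals lets the result depend on the position.\<close>

lemma calls_mapi:
  assumes p: "proc_at \<Gamma> p (mapi_body p q)"
    and "\<And>j. i \<le> j \<Longrightarrow> j < i + n \<Longrightarrow> calls \<Gamma> q (Pair e (Pair (Num (int j)) (g j))) (r j) T"
  shows "calls \<Gamma> p (Pair e (Pair (Num (int i)) (enc_list g [i..<i+n]))) (enc_list r [i..<i+n])
           ((T + 50) * (n + 1))"
  using assms(2)
proof (induction n arbitrary: i)
  case 0
  show ?case
    by (rule callsI[OF p], unfold mapi_body_def, intro wp_intros)
       (auto simp: init_regs_def)
next
  case (Suc n)
  have ih: "calls \<Gamma> p (Pair e (Pair (Num (int (Suc i))) (enc_list g [Suc i..<Suc i+n])))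
      (enc_list r [Suc i..<Suc i+n]) ((T + 50) * (n + 1))"
    by (rule Suc.IH) (use Suc.prems in auto)
  have hd: "calls \<Gamma> q (Pair e (Pair (Num (int i)) (g i))) (r i) T"
    by (rule Suc.prems) auto
  have u: "[i..<i + Suc n] = i # [Suc i..<Suc i + n]"
    by (simp add: upt_rec)
  show ?case unfolding u
    by (rule callsI[OF p], unfold mapi_body_def, intro wp_intros wp_Call[OF ih] wp_Call[OF hd])
       (auto simp: init_regs_def algebra_simps)
qed

definition zip_body :: "nat \<Rightarrow> nat \<Rightarrow> com" where
  "zip_body p q = If (IsPair (Snd (Snd (reg 0))))
     (Seq (Call (Lit 1) p (mk_triple (Fst (reg 0)) (Snd (Fst (Snd (reg 0)))) (Snd (Snd (Snd (reg 0))))))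
     (Seq (Call (Lit 2) q (mk_triple (Fst (reg 0)) (Fst (Fst (Snd (reg 0)))) (Fst (Snd (Snd (reg 0))))))
          (Assign (Lit 0) (MkPair (reg 2) (reg 1)))))
     (Assign (Lit 0) (Lit 0))"

lemma calls_zip:
  assumes p: "proc_at \<Gamma> p (zip_body p q)"
    and q: "\<And>x. x \<in> set xs \<Longrightarrow> calls \<Gamma> q (Pair e (Pair (g x) (h x))) (r x) T"
  shows "calls \<Gamma> p (Pair e (Pair (enc_list g xs) (enc_list h xs))) (enc_list r xs)
           ((T + 50) * (length xs + 1))"
  using q
proof (induction xs)
  case Nil
  show ?case
    by (rule callsI[OF p], unfold zip_body_def, intro wp_intros)
       (auto simp: init_regs_def)
next
  case (Cons x xs)
  note ih = Cons.IH[OF Cons.prems] and hd = Cons.prems[of x]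
  show ?case
    by (rule callsI[OF p], unfold zip_body_def, intro wp_intros wp_Call[OF ih] wp_Call[OF hd])
       (auto simp: init_regs_def algebra_simps)
qed

definition append_body :: "nat \<Rightarrow> com" where
  "append_body p = If (IsPair (Fst (reg 0)))
     (Seq (Call (Lit 1) p (MkPair (Snd (Fst (reg 0))) (Snd (reg 0))))
          (Assign (Lit 0) (MkPair (Fst (Fst (reg 0))) (reg 1))))
     (Assign (Lit 0) (Snd (reg 0)))"

lemma calls_append_list:
  assumes p: "proc_at \<Gamma> p (append_body p)"
  shows "calls \<Gamma> p (Pair (enc_list g xs) (enc_list g ys)) (enc_list g (xs @ ys)) (50 * (length xs + 1))"
proof (induction xs)
  case Nil
  show ?case
    by (rule callsI[OF p], unfold append_body_def, intro wp_intros)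
       (auto simp: init_regs_def)
next
  case (Cons x xs)
  show ?case
    by (rule callsI[OF p], unfold append_body_def, intro wp_intros wp_Call[OF Cons.IH])
       (auto simp: init_regs_def algebra_simps)
qed

definition nth_body :: "nat \<Rightarrow> com" where
  "nth_body p = If (Less (Lit 0) (Fst (reg 0)))
     (Call (Lit 0) p (MkPair (Minus (Fst (reg 0)) (Lit 1)) (Snd (Snd (reg 0)))))
     (Assign (Lit 0) (Fst (Snd (reg 0))))"

lemma calls_nth:
  assumes p: "proc_at \<Gamma> p (nth_body p)" and "i < length xs"
  shows "calls \<Gamma> p (Pair (Num (int i)) (enc_list g xs)) (g (xs ! i)) (50 * (i + 1))"
  using assms(2)
proof (induction xs arbitrary: i)
  case (Cons x xs)
  show ?case
  proof (cases i)
    case 0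
    show ?thesis
      unfolding 0
      by (rule callsI[OF p], unfold nth_body_def, intro wp_intros)
         (auto simp: init_regs_def)
  next
    case (Suc j)
    with Cons.prems have "j < length xs" by simp
    note ih = Cons.IH[OF this]
    show ?thesis
      unfolding Suc
      by (rule callsI[OF p], unfold nth_body_def, intro wp_intros wp_Call[OF ih])
         (auto simp: init_regs_def)
  qed
qed simp

section \<open>Procedures on families of tuples\<close>

text \<open>The machine has no Boolean connectives; for bits, disjunction is positivity of the
  sum.\<close>

definition or_body :: com where
  "or_body = Assign (Lit 0) (Less (Lit 0) (Plus (Fst (Snd (reg 0))) (Snd (Snd (reg 0)))))"

lemma calls_or:
  assumes p: "proc_at \<Gamma> p or_body"
  shows "calls \<Gamma> p (Pair e (Pair (enc_bool a) (enc_bool b))) (enc_bool (a \<or> b)) 20"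
  by (rule callsI[OF p], unfold or_body_def, intro wp_intros)
     (auto simp: init_regs_def enc_bool_def)

lemma calls_union:
  assumes "proc_at \<Gamma> q or_body" and "proc_at \<Gamma> p (zip_body p q)"
  shows "calls \<Gamma> p (Pair e (Pair (enc_set n A) (enc_set n B))) (enc_set n (A \<union> B)) (70 * (n + 1))"
proof -
  have "calls \<Gamma> p (Pair e (Pair (enc_list (\<lambda>v. enc_bool (v \<in> A)) [0..<n])
        (enc_list (\<lambda>v. enc_bool (v \<in> B)) [0..<n])))
      (enc_list (\<lambda>v. enc_bool (v \<in> A \<or> v \<in> B)) [0..<n]) ((20 + 50) * (length [0..<n] + 1))"
    by (rule calls_zip[OF assms(2) calls_or[OF assms(1)]])
  then show ?thesis by (simp add: enc_set_def)
qed

lemma calls_tuple_union: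
  assumes "proc_at \<Gamma> p (zip_body p q)"
    and q: "\<And>A B. calls \<Gamma> q (Pair e (Pair (enc_set n A) (enc_set n B))) (enc_set n (A \<union> B)) T"
    and len: "length B = k" "length D = k"
  shows "calls \<Gamma> p (Pair e (Pair (enc_list (enc_set n) B) (enc_list (enc_set n) D)))
           (enc_list (enc_set n) (tuple_union B D)) ((T + 50) * (k + 1))"
proof -
  \<comment> \<open>\<open>calls_zip\<close> walks a single list under two encoders, so the two
    tuples are presented as the projections of \<open>zip B D\<close>.\<close>
  have "calls \<Gamma> p (Pair e (Pair (enc_list (\<lambda>x. enc_set n (fst x)) (zip B D))
        (enc_list (\<lambda>x. enc_set n (snd x)) (zip B D))))
      (enc_list (\<lambda>x. enc_set n (fst x \<union> snd x)) (zip B D)) ((T + 50) * (length (zip B D) + 1))"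
    by (rule calls_zip[OF assms(1) q])
  then show ?thesis
    by (simp add: len enc_list_map[symmetric] tuple_union_def case_prod_beta')
       (simp add: enc_list_map)
qed

definition product_body :: "nat \<Rightarrow> nat \<Rightarrow> nat \<Rightarrow> com" where
  "product_body p q a = If (IsPair (Fst (reg 0)))
     (Seq (Call (Lit 1) p (MkPair (Snd (Fst (reg 0))) (Snd (reg 0))))
     (Seq (Call (Lit 2) q (mk_triple (Lit 0) (Fst (Fst (reg 0))) (Snd (reg 0))))
          (Call (Lit 0) a (MkPair (reg 2) (reg 1)))))
     (Assign (Lit 0) (Lit 0))"

text \<open>Appending is linear in its first argument. That argument is always the row just
  produced, never the accumulated rest, so the appends cost only a constant per pair.\<close>

lemma calls_product:
  assumes p: "proc_at \<Gamma> p (product_body p q a)" and a: "proc_at \<Gamma> a (append_body a)"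
    and q: "\<And>x. x \<in> set xs \<Longrightarrow>
      calls \<Gamma> q (Pair (Num 0) (Pair (g x) (enc_list g ys))) (enc_list g (map (h x) ys)) T"
  shows "calls \<Gamma> p (Pair (enc_list g xs) (enc_list g ys)) (enc_list g (map (case_prod h) (List.product xs ys)))
           ((T + 50 * (length ys + 2)) * (length xs + 1))"
  using q
proof (induction xs)
  case Nil
  show ?case
    by (rule callsI[OF p], unfold product_body_def, intro wp_intros)
       (auto simp: init_regs_def)
next
  case (Cons x xs)
  note ih = Cons.IH[OF Cons.prems] and hd = Cons.prems[of x]
    and app = calls_append_list[OF a, of g "map (h x) ys" "map (case_prod h) (List.product xs ys)"]
  show ?case
    by (rule callsI[OF p], unfold product_body_def,
        intro wp_intros wp_Call[OF ih] wp_Call[OF hd] wp_Call[OF app])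
       (auto simp: init_regs_def algebra_simps comp_def)
qed

text \<open>At most one of the two strict comparisons yields 1, and neither does exactly for equal
  numbers.\<close>

definition eq_body :: com where
  "eq_body = Assign (Lit 0) (Minus (Minus (Lit 1) (Less (Fst (reg 0)) (Fst (Snd (reg 0)))))
     (Less (Fst (Snd (reg 0))) (Fst (reg 0))))"

lemma calls_eq:
  assumes p: "proc_at \<Gamma> p eq_body"
  shows "calls \<Gamma> p (Pair (Num i) (Pair (Num j) x)) (enc_bool (i = j)) 30"
  by (rule callsI[OF p], unfold eq_body_def, intro wp_intros)
     (auto simp: init_regs_def enc_bool_def)

text \<open>The entries of the list are never inspected: it only supplies the length, while the key
  is compared with the running index.\<close>

lemma calls_singleton:
  assumes "proc_at \<Gamma> q eq_body" and "proc_at \<Gamma> p (mapi_body p q)"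
  shows "calls \<Gamma> p (Pair (Num i) (Pair (Num 0) (enc_list g [0..<n]))) (enc_set n {v. i = int v})
           (80 * (n + 1))"
proof -
  have "calls \<Gamma> p (Pair (Num i) (Pair (Num (int 0)) (enc_list g [0..<0 + n])))
      (enc_list (\<lambda>v. enc_bool (i = int v)) [0..<0 + n]) ((30 + 50) * (n + 1))"
    by (rule calls_mapi[OF assms(2) calls_eq[OF assms(1)]])
  then show ?thesis
    by (simp add: enc_set_def)
qed

section \<open>Words over two letters: the tuples over a single vertex\<close>

fun all_tuples :: "'a \<Rightarrow> 'a \<Rightarrow> nat \<Rightarrow> 'a list list" where
  "all_tuples a b 0 = [[]]"
| "all_tuples a b (Suc k) = concat (map (\<lambda>t. [a # t, b # t]) (all_tuples a b k))"

lemma length_all_tuples: "length (all_tuples a b k) = 2 ^ k"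
proof (induction k)
  case (Suc k)
  have "length (concat (map (\<lambda>t. [a # t, b # t]) ts)) = 2 * length ts" for ts
    by (induction ts) auto
  with Suc show ?case by simp
qed simp

lemma set_all_tuples: "set (all_tuples a b k) = {t. length t = k \<and> set t \<subseteq> {a, b}}"
proof (induction k)
  case (Suc k)
  show ?case
  proof (rule set_eqI)
    fix t show "t \<in> set (all_tuples a b (Suc k)) \<longleftrightarrow> t \<in> {t. length t = Suc k \<and> set t \<subseteq> {a, b}}"
      using Suc by (cases t) auto
  qed
qed auto

lemma distinct_all_tuples:
  assumes "a \<noteq> b"
  shows "distinct (all_tuples a b k)"
proof (induction k)
  case (Suc k)
  have "distinct (concat (map (\<lambda>t. [a # t, b # t]) ts))" if "distinct ts" for ts
    using that assms by (induction ts) auto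
  with Suc show ?case by simp
qed simp

definition cons_either_body :: "nat \<Rightarrow> com" where
  "cons_either_body p = If (IsPair (Snd (reg 0)))
     (Seq (Call (Lit 1) p (MkPair (Fst (reg 0)) (Snd (Snd (reg 0)))))
          (Assign (Lit 0) (mk_triple (MkPair (Fst (Fst (reg 0))) (Fst (Snd (reg 0))))
             (MkPair (Snd (Fst (reg 0))) (Fst (Snd (reg 0)))) (reg 1))))
     (Assign (Lit 0) (Lit 0))"

lemma calls_cons_either:
  assumes p: "proc_at \<Gamma> p (cons_either_body p)"
  shows "calls \<Gamma> p (Pair (Pair (g a) (g b)) (enc_list (enc_list g) ts))
           (enc_list (enc_list g) (concat (map (\<lambda>t. [a # t, b # t]) ts))) (50 * (length ts + 1))"
proof (induction ts)
  case Nil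
  show ?case
    by (rule callsI[OF p], unfold cons_either_body_def, intro wp_intros)
       (auto simp: init_regs_def)
next
  case (Cons t ts)
  show ?case
    by (rule callsI[OF p], unfold cons_either_body_def, intro wp_intros wp_Call[OF Cons.IH])
       (auto simp: init_regs_def)
qed

definition all_tuples_body :: "nat \<Rightarrow> nat \<Rightarrow> com" where
  "all_tuples_body p q = If (Less (Lit 0) (Fst (reg 0)))
     (Seq (Call (Lit 1) p (MkPair (Minus (Fst (reg 0)) (Lit 1)) (Snd (reg 0))))
          (Call (Lit 0) q (MkPair (Snd (reg 0)) (reg 1))))
     (Assign (Lit 0) (MkPair (Lit 0) (Lit 0)))"

text \<open>Prefixing an entry creates one pair that shares the old tail, so a round costs time
  proportional to the number of tuples and not to their total length. The rounds form a geometric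
  sum, which avoids a factor \<open>k\<close>.\<close>

lemma calls_all_tuples:
  assumes p: "proc_at \<Gamma> p (all_tuples_body p q)" and q: "proc_at \<Gamma> q (cons_either_body q)"
  shows "calls \<Gamma> p (Pair (Num (int k)) (Pair (g a) (g b)))
           (enc_list (enc_list g) (all_tuples a b k)) (150 * 2 ^ k)"
proof (induction k)
  case 0
  show ?case
    by (rule callsI[OF p], unfold all_tuples_body_def, intro wp_intros)
       (auto simp: init_regs_def)
next
  case (Suc k)
  note ce = calls_cons_either[OF q, of g a b "all_tuples a b k", unfolded length_all_tuples]
  \<comment> \<open>Makes \<open>2^k\<close> a positive atom, so that additive constants are
    absorbed by linear arithmetic.\<close>
  obtain m where m: "2 ^ k = Suc m"
    by (metis not0_implies_Suc power_not_zero zero_neq_numeral)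
  show ?case
    by (rule callsI[OF p], unfold all_tuples_body_def,
        intro wp_intros wp_Call[OF Suc.IH] wp_Call[OF ce])
       (auto simp: init_regs_def m)
qed

section \<open>All-pairs distances\<close>

text \<open>\<open>walk_dist G w u v\<close> is the length of a shortest walk from \<open>u\<close> to \<open>v\<close> whose interior vertices are
  smaller than \<open>w\<close>.\<close>

fun walk_dist :: "wgraph \<Rightarrow> nat \<Rightarrow> nat \<Rightarrow> nat \<Rightarrow> enat" where
  "walk_dist G 0 u v = (if u = v then 0 else if {u, v} \<in> edges G then 1 else \<infinity>)"
| "walk_dist G (Suc w) u v = min (walk_dist G w u v) (walk_dist G w u w + walk_dist G w w v)"

lemma gdist_le: "(u, v) \<in> adj_rel G ^^ m \<Longrightarrow> gdist G u v \<le> enat m"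
  unfolding gdist_def by (rule INF_lower) simp

text \<open>A finite value rules out the empty set, whose infimum is infinite, and a nonempty set of
  naturals attains its infimum.\<close>

lemma gdist_walk:
  assumes "gdist G u v = enat m"
  shows "(u, v) \<in> adj_rel G ^^ m"
proof -
  let ?M = "enat ` {m. (u, v) \<in> adj_rel G ^^ m}"
  have "?M \<noteq> {}"
    using assms unfolding gdist_def by (metis Inf_enat_def enat.distinct(1))
  then have "Inf ?M \<in> ?M"
    unfolding Inf_enat_def by (auto intro: LeastI)
  with assms show ?thesis
    by (auto simp: gdist_def)
qed

lemma gdist_triangle: "gdist G u v \<le> gdist G u x + gdist G x v"
proof (cases "gdist G u x")
  case (enat a)
  show ?thesis
  proof (cases "gdist G x v")
    fix b assume b: "gdist G x v = enat b"
    have "(u, v) \<in> adj_rel G ^^ (a + b)"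
      using gdist_walk[OF enat] gdist_walk[OF b] unfolding relpow_add by blast
    from gdist_le[OF this] show ?thesis by (simp add: enat b)
  qed simp
qed simp

lemma gdist_le_walk_dist: "gdist G u v \<le> walk_dist G w u v"
proof (induction w arbitrary: u v)
  case 0
  have "gdist G u v \<le> enat 1" if "{u, v} \<in> edges G"
    by (rule gdist_le) (use that in \<open>simp add: adj_rel_def\<close>)
  moreover have "gdist G u u \<le> enat 0"
    by (rule gdist_le) simp
  ultimately show ?case by (auto simp: one_enat_def zero_enat_def)
next
  case (Suc w)
  have "gdist G u v \<le> walk_dist G w u w + walk_dist G w w v"
    using gdist_triangle add_mono[OF Suc Suc] by (rule order_trans)
  with Suc show ?case by simp
qed

text \<open>Takes the place of decomposing shortest walks. For \<open>x = w\<close> a loop at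
  \<open>w\<close> only adds length, so both summands on the right fall back to level
  \<open>w\<close>. For \<open>x < w\<close> the two minima on the right expand into four routes,
  which are treated one by one.\<close>

lemma walk_dist_triangle:
  "x < w \<Longrightarrow> walk_dist G w u v \<le> walk_dist G w u x + walk_dist G w x v"
proof (induction w arbitrary: u v x)
  case (Suc w)
  let ?d = "walk_dist G w"
  show ?case
  proof (cases "x = w")
    case True
    have "?d u w \<le> ?d u w + ?d w w" "?d w v \<le> ?d w w + ?d w v"
      by (simp_all add: le_iff_add add.commute)
    then show ?thesis
      unfolding True by (simp add: min_def)
  next
    case False
    with Suc.prems have x: "x < w" by simp
    have tri: "?d a b \<le> ?d a x + ?d x b" for a b
      by (rule Suc.IH[OF x])
    let ?r = "walk_dist G (Suc w) u v"
    have r: "?r \<le> ?d u v" "?r \<le> ?d u w + ?d w v" by simp_all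
    have "?r \<le> ?d u x + ?d x v"
      using r(1) tri by (rule order_trans)
    moreover have "?r \<le> ?d u x + (?d x w + ?d w v)"
      using order_trans[OF r(2) add_right_mono[OF tri[of u w]]] by (simp only: add.assoc)
    moreover have "?r \<le> (?d u w + ?d w x) + ?d x v"
      using order_trans[OF r(2) add_left_mono[OF tri[of w v]]] by (simp only: add.assoc)
    \<comment> \<open>Both halves visit \<open>w\<close>: the detour from \<open>w\<close> to
      \<open>x\<close> and back is dropped, as lengths are nonnegative.\<close>
    moreover have "?r \<le> (?d u w + ?d w x) + (?d x w + ?d w v)"
    proof -
      have "?d u w + ?d w v \<le> (?d u w + ?d w x) + (?d x w + ?d w v)"
        by (intro add_mono) (simp_all add: le_iff_add add.commute)
      with r(2) show ?thesis by (rule order_trans)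
    qed
    ultimately show ?thesis
      by (simp only: walk_dist.simps(2)[of G w u x] walk_dist.simps(2)[of G w x v])
         (simp add: min_def split: if_splits)
  qed
qed simp

lemma walk_dist_le_0: "walk_dist G w u v \<le> walk_dist G 0 u v"
  by (induction w) (auto simp del: walk_dist.simps(1) intro: min.coboundedI1)

text \<open>A walk is extended edge by edge. The end \<open>x\<close> of the prefix lies on an edge,
  hence is a vertex below \<open>order G\<close> and may serve as the middle point of the triangle
  inequality; the last edge is already counted at level 0.\<close>

lemma walk_dist_order:
  assumes "weighted_graph k G"
  shows "walk_dist G (order G) u v = gdist G u v"
proof (rule antisym)
  have "walk_dist G (order G) u v \<le> enat m" if "(u, v) \<in> adj_rel G ^^ m" for m
    using that
  proof (induction m arbitrary: v)
    case 0
    then show ?case using walk_dist_le_0[of G "order G" u v] by (simp add: zero_enat_def)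
  next
    case (Suc m)
    then obtain x where x: "(u, x) \<in> adj_rel G ^^ m" and e: "{x, v} \<in> edges G"
      by (auto simp: adj_rel_def)
    have "x < order G"
      using assms e by (auto simp: weighted_graph_def verts_def)
    then have "walk_dist G (order G) u v \<le> walk_dist G (order G) u x + walk_dist G (order G) x v"
      by (rule walk_dist_triangle)
    also have "\<dots> \<le> enat m + walk_dist G 0 x v"
      by (intro add_mono Suc.IH[OF x] walk_dist_le_0)
    also have "\<dots> \<le> enat (Suc m)"
      using e by (auto simp: one_enat_def zero_enat_def)
    finally show ?case .
  qed
  then show "walk_dist G (order G) u v \<le> gdist G u v"
    unfolding gdist_def by (intro INF_greatest) simp
qed (rule gdist_le_walk_dist)

section \<open>Floyd-Warshall on matrices stored as lists\<close>

definition init_entry_body :: com where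
  "init_entry_body = If (Plus (Less (Fst (reg 0)) (Fst (Snd (reg 0)))) (Less (Fst (Snd (reg 0))) (Fst (reg 0))))
     (If (Snd (Snd (reg 0))) (Assign (Lit 0) (Lit 1)) (Assign (Lit 0) (Lit (-1))))
     (Assign (Lit 0) (Lit 0))"

lemma calls_init_entry:
  assumes p: "proc_at \<Gamma> p init_entry_body"
  shows "calls \<Gamma> p (Pair (Num (int u)) (Pair (Num (int v)) (enc_bool ({u, v} \<in> edges G))))
           (enc_enat (walk_dist G 0 u v)) 30"
  by (rule callsI[OF p], unfold init_entry_body_def, intro wp_intros)
     (auto simp: init_regs_def enc_bool_def enc_enat_def one_enat_def zero_enat_def split: if_splits)

definition init_row_body :: "nat \<Rightarrow> com" where
  "init_row_body q = Call (Lit 0) q (mk_triple (Fst (Snd (reg 0))) (Lit 0) (Snd (Snd (reg 0))))"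

lemma calls_init_matrix:
  assumes e: "proc_at \<Gamma> e init_entry_body" and m: "proc_at \<Gamma> m (mapi_body m e)"
    and r: "proc_at \<Gamma> r (init_row_body m)" and p: "proc_at \<Gamma> p (mapi_body p r)"
  shows "calls \<Gamma> p (Pair (Num 0) (Pair (Num 0) (enc_matrix n (\<lambda>u v. enc_bool ({u, v} \<in> edges G)))))
           (enc_matrix n (\<lambda>u v. enc_enat (walk_dist G 0 u v))) (200 * (n + 1) ^ 2)"
proof -
  let ?a = "\<lambda>u. enc_list (\<lambda>v. enc_bool ({u, v} \<in> edges G)) [0..<0+n]"
  let ?d = "\<lambda>u. enc_list (\<lambda>v. enc_enat (walk_dist G 0 u v)) [0..<0+n]"
  have 1: "calls \<Gamma> m (Pair (Num (int u)) (Pair (Num (int 0)) (?a u))) (?d u) ((30 + 50) * (n + 1))" for u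
    by (rule calls_mapi[OF m calls_init_entry[OF e]])
  have 2: "calls \<Gamma> r (Pair (Num 0) (Pair (Num (int u)) (?a u))) (?d u) (100 * (n + 1))" for u
    by (rule callsI[OF r], unfold init_row_body_def, intro wp_intros wp_Call[OF 1[of u]])
       (auto simp: init_regs_def)
  have "calls \<Gamma> p (Pair (Num 0) (Pair (Num (int 0)) (enc_list ?a [0..<0+n]))) (enc_list ?d [0..<0+n])
      ((100 * (n + 1) + 50) * (n + 1))"
    by (rule calls_mapi[OF p 2])
  then have "calls \<Gamma> p (Pair (Num 0) (Pair (Num (int 0)) (enc_list ?a [0..<0+n]))) (enc_list ?d [0..<0+n])
      (200 * (n + 1) ^ 2)"
    by (rule calls_mono) (simp add: power2_eq_square algebra_simps)
  then show ?thesis by (simp add: enc_matrix_def)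
qed

text \<open>Infinity is coded by -1, which an integer comparison would take for the smallest value;
  hence all three signs are tested before anything is compared.\<close>

definition relax_entry_body :: com where
  "relax_entry_body =
     If (Less (Fst (reg 0)) (Lit 0)) (Assign (Lit 0) (Fst (Snd (reg 0))))
    (If (Less (Snd (Snd (reg 0))) (Lit 0)) (Assign (Lit 0) (Fst (Snd (reg 0))))
    (If (Less (Fst (Snd (reg 0))) (Lit 0)) (Assign (Lit 0) (Plus (Fst (reg 0)) (Snd (Snd (reg 0)))))
    (If (Less (Plus (Fst (reg 0)) (Snd (Snd (reg 0)))) (Fst (Snd (reg 0))))
        (Assign (Lit 0) (Plus (Fst (reg 0)) (Snd (Snd (reg 0)))))
        (Assign (Lit 0) (Fst (Snd (reg 0)))))))"

lemma calls_relax_entry: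
  assumes p: "proc_at \<Gamma> p relax_entry_body"
  shows "calls \<Gamma> p (Pair (enc_enat a) (Pair (enc_enat x) (enc_enat y))) (enc_enat (min x (a + y))) 50"
  by (rule callsI[OF p], unfold relax_entry_body_def, intro wp_intros; cases a; cases x; cases y)
     (auto simp: init_regs_def enc_enat_def min_def split: if_splits)

definition relax_row_body :: "nat \<Rightarrow> nat \<Rightarrow> com" where
  "relax_row_body q z =
     Seq (Call (Lit 1) q (MkPair (Fst (reg 0)) (Snd (Snd (reg 0)))))
         (Call (Lit 0) z (mk_triple (reg 1) (Snd (Snd (reg 0))) (Fst (Snd (reg 0)))))"

text \<open>Access to a list entry takes linear time, but the pivot entry is fetched once per row,
  where a linear pass is made anyway. The round therefore stays quadratic.\<close>

lemma calls_relax_matrix: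
  assumes e: "proc_at \<Gamma> e relax_entry_body" and z: "proc_at \<Gamma> z (zip_body z e)"
    and q: "proc_at \<Gamma> q (nth_body q)" and r: "proc_at \<Gamma> r (relax_row_body q z)"
    and p: "proc_at \<Gamma> p (map_body p r)" and w: "w < n"
  shows "calls \<Gamma> p (Pair (Num (int w)) (Pair (enc_list (\<lambda>v. enc_enat (walk_dist G w w v)) [0..<n])
             (enc_matrix n (\<lambda>u v. enc_enat (walk_dist G w u v)))))
           (enc_matrix n (\<lambda>u v. enc_enat (walk_dist G (Suc w) u v))) (300 * (n + 1) ^ 2)"
proof -
  let ?d = "\<lambda>w u. enc_list (\<lambda>v. enc_enat (walk_dist G w u v)) [0..<n]"
  have 1: "calls \<Gamma> q (Pair (Num (int w)) (?d w u)) (enc_enat (walk_dist G w u w)) (50 * (w + 1))" for u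
    using calls_nth[OF q, of w "[0..<n]" "\<lambda>v. enc_enat (walk_dist G w u v)"] w by simp
  have 2: "calls \<Gamma> z (Pair (enc_enat (walk_dist G w u w)) (Pair (?d w u) (?d w w))) (?d (Suc w) u)
      ((50 + 50) * (length [0..<n] + 1))" for u
    by (rule calls_zip[OF z], unfold walk_dist.simps(2), rule calls_relax_entry[OF e])
  have 3: "calls \<Gamma> r (Pair (Num (int w)) (Pair (?d w w) (?d w u))) (?d (Suc w) u) (200 * (n + 1))" for u
    using w
    by - (rule callsI[OF r], unfold relax_row_body_def,
        intro wp_intros wp_Call[OF 1[of u]] wp_Call[OF 2[of u]]; auto simp: init_regs_def)
  have "calls \<Gamma> p (Pair (Num (int w)) (Pair (?d w w) (enc_list (?d w) [0..<n])))
      (enc_list (?d (Suc w)) [0..<n]) ((200 * (n + 1) + 50) * (length [0..<n] + 1))"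
    by (rule calls_map[OF p 3])
  then show ?thesis
    unfolding enc_matrix_def
    by (rule calls_mono) (simp add: power2_eq_square algebra_simps)
qed

definition fw_body :: "nat \<Rightarrow> nat \<Rightarrow> nat \<Rightarrow> com" where
  "fw_body p q m = If (Less (Fst (reg 0)) (Fst (Snd (reg 0))))
     (Seq (Call (Lit 1) q (MkPair (Fst (reg 0)) (Snd (Snd (reg 0)))))
     (Seq (Call (Lit 2) m (mk_triple (Fst (reg 0)) (reg 1) (Snd (Snd (reg 0)))))
          (Call (Lit 0) p (mk_triple (Plus (Fst (reg 0)) (Lit 1)) (Fst (Snd (reg 0))) (reg 2)))))
     (Assign (Lit 0) (Snd (Snd (reg 0))))"

lemma calls_fw:
  assumes e: "proc_at \<Gamma> e relax_entry_body" and z: "proc_at \<Gamma> z (zip_body z e)"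
    and q: "proc_at \<Gamma> q (nth_body q)" and r: "proc_at \<Gamma> r (relax_row_body q z)"
    and m: "proc_at \<Gamma> m (map_body m r)" and p: "proc_at \<Gamma> p (fw_body p q m)"
  shows "w + d = n \<Longrightarrow>
    calls \<Gamma> p (Pair (Num (int w)) (Pair (Num (int n)) (enc_matrix n (\<lambda>u v. enc_enat (walk_dist G w u v)))))
      (enc_matrix n (\<lambda>u v. enc_enat (walk_dist G n u v))) (400 * (n + 1) ^ 2 * (d + 1))"
proof (induction d arbitrary: w)
  case 0
  then have "n = w" by simp
  then show ?case
    by - (rule callsI[OF p], unfold fw_body_def, intro wp_intros;
       auto simp: init_regs_def power2_eq_square)
next
  case (Suc d)
  let ?M = "\<lambda>w. enc_matrix n (\<lambda>u v. enc_enat (walk_dist G w u v))"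
  have w: "w < n" using Suc.prems by simp
  have 1: "calls \<Gamma> q (Pair (Num (int w)) (?M w)) (enc_list (\<lambda>v. enc_enat (walk_dist G w w v)) [0..<n])
      (50 * (w + 1))"
    using calls_nth[OF q, of w "[0..<n]" "\<lambda>u. enc_list (\<lambda>v. enc_enat (walk_dist G w u v)) [0..<n]"] w
    by (simp add: enc_matrix_def)
  note 2 = calls_relax_matrix[OF e z q r m w, of G]
  have 3: "calls \<Gamma> p (Pair (Num (int (Suc w))) (Pair (Num (int n)) (?M (Suc w)))) (?M n)
      (400 * (n + 1) ^ 2 * (d + 1))"
    by (rule Suc.IH) (use Suc.prems in simp)
  have le: "50 * w + 100 \<le> 100 * (Suc n)\<^sup>2"
    using w by (simp add: power2_eq_square)
  show ?case
    by (rule callsI[OF p], unfold fw_body_def, intro wp_intros wp_Call[OF 1] wp_Call[OF 2] wp_Call[OF 3])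
       (use w le in \<open>auto simp: init_regs_def\<close>)
qed

section \<open>Dominating families\<close>

text \<open>For \<open>\<C> \<subseteq> \<B>\<close> this is representation, with the maxima eliminated.\<close>

definition dominates ::
  "nat \<Rightarrow> problem \<Rightarrow> wgraph \<Rightarrow> nat set \<Rightarrow> nat set list set \<Rightarrow> nat set list set \<Rightarrow> bool" where
  "dominates k \<P> G A \<C> \<B> \<longleftrightarrow>
     (\<forall>D \<in> tuples k (verts G - A). \<forall>B \<in> \<B>. tuple_union B D \<in> \<P> G \<longrightarrow>
        (\<exists>C \<in> \<C>. tuple_union C D \<in> \<P> G \<and> obj G B \<le> obj G C))"

lemma dominates_trans:
  "dominates k \<P> G A \<C> \<B> \<Longrightarrow> dominates k \<P> G A \<B> \<A> \<Longrightarrow> dominates k \<P> G A \<C> \<A>"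
  unfolding dominates_def by (meson order_trans)

lemma represents_dominates:
  assumes "represents k \<P> G A \<C> \<B>" and "\<C> \<subseteq> \<B>" and "finite \<B>"
  shows "dominates k \<P> G A \<C> \<B>"
  unfolding dominates_def
proof (intro ballI impI)
  fix D B assume D: "D \<in> tuples k (verts G - A)" and B: "B \<in> \<B>" "tuple_union B D \<in> \<P> G"
  let ?M = "\<lambda>\<X>. obj G ` {B \<in> \<X>. tuple_union B D \<in> \<P> G}"
  have eq: "best \<P> G \<C> D = best \<P> G \<B> D"
    using assms(1) D by (simp add: represents_def)
  have "obj G B \<in> ?M \<B>" using B by simp
  then have ne: "?M \<B> \<noteq> {}" by (metis empty_iff)
  have fin: "finite (?M \<C>)" "finite (?M \<B>)"
    using assms(2,3) by (auto intro: finite_subset)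
  \<comment> \<open>Only the empty maximum has value -infinity, so equal values carry nonemptiness
    over from \<open>\<B>\<close>.\<close>
  have ne': "?M \<C> \<noteq> {}"
    using eq ne unfolding best_def Let_def by (metis MInfty_neq_ereal(1))
  have "Max (?M \<C>) = Max (?M \<B>)"
    using eq unfolding best_def Let_def if_not_P[OF ne] if_not_P[OF ne'] by simp
  moreover have "Max (?M \<C>) \<in> ?M \<C>"
    using fin(1) ne' by (rule Max_in)
  moreover have "obj G B \<le> Max (?M \<B>)"
    using fin(2) \<open>obj G B \<in> ?M \<B>\<close> by (rule Max_ge)
  ultimately show "\<exists>C \<in> \<C>. tuple_union C D \<in> \<P> G \<and> obj G B \<le> obj G C" by auto
qed

section \<open>Tuples, their unions and their objective values\<close>

lemma tuplesD: "B \<in> tuples k A \<Longrightarrow> length B = k" "B \<in> tuples k A \<Longrightarrow> i < k \<Longrightarrow> B ! i \<subseteq> A"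
  by (auto simp: tuples_def) (meson nth_mem Pow_iff subsetD)

lemma tuplesI: "length B = k \<Longrightarrow> (\<And>i. i < k \<Longrightarrow> B ! i \<subseteq> A) \<Longrightarrow> B \<in> tuples k A"
  by (auto simp: tuples_def in_set_conv_nth subset_iff)

lemma finite_tuples: "finite A \<Longrightarrow> finite (tuples k A)"
  unfolding tuples_def using finite_lists_length_eq[of "Pow A" k] by (simp add: conj_commute)

lemma length_tuple_union [simp]: "length (tuple_union B D) = min (length B) (length D)"
  by (simp add: tuple_union_def)

lemma nth_tuple_union [simp]:
  "i < length B \<Longrightarrow> i < length D \<Longrightarrow> tuple_union B D ! i = B ! i \<union> D ! i"
  by (simp add: tuple_union_def)

lemma tuple_union_assoc: "tuple_union (tuple_union B C) D = tuple_union B (tuple_union C D)"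
  by (rule nth_equalityI) auto

lemma tuple_union_commute: "tuple_union B D = tuple_union D B"
  by (rule nth_equalityI) auto

lemma tuple_union_in_tuples:
  assumes "B \<in> tuples k A" and "D \<in> tuples k C" and "A \<union> C \<subseteq> E"
  shows "tuple_union B D \<in> tuples k E"
  using tuplesD[OF assms(1)] tuplesD[OF assms(2)] assms(3) by (intro tuplesI) (auto, blast+)

lemma tuple_union_restrict:
  assumes "B \<in> tuples k A" and "D \<in> tuples k C" and "A \<inter> C = {}"
  shows "map (\<lambda>X. X \<inter> A) (tuple_union B D) = B"
proof (rule nth_equalityI)
  fix i assume "i < length (map (\<lambda>X. X \<inter> A) (tuple_union B D))"
  then show "map (\<lambda>X. X \<inter> A) (tuple_union B D) ! i = B ! i"
    using assms tuplesD(2)[OF assms(1), of i] tuplesD(2)[OF assms(2), of i]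
    by (auto simp: tuplesD(1))
qed (use assms in \<open>simp add: tuplesD(1)\<close>)

text \<open>Intersecting with either part recovers the factor. This makes the product list at an
  internal node free of repetitions, as a valid input of the routine must be.\<close>

lemma inj_on_tuple_union:
  assumes "A1 \<inter> A2 = {}"
  shows "inj_on (case_prod tuple_union) (tuples k A1 \<times> tuples k A2)"
proof (rule inj_onI, clarify)
  fix B D B' D'
  assume B: "B \<in> tuples k A1" "B' \<in> tuples k A1" and D: "D \<in> tuples k A2" "D' \<in> tuples k A2"
    and eq: "tuple_union B D = tuple_union B' D'"
  show "B = B' \<and> D = D'"
    using tuple_union_restrict[OF B(1) D(1) assms] tuple_union_restrict[OF B(2) D(2) assms]
      tuple_union_restrict[OF D(1) B(1)] tuple_union_restrict[OF D(2) B(2)] assms eq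
    by (metis Int_commute tuple_union_commute)
qed

text \<open>The objective counts the weight of the empty label for every uncovered vertex, hence the
  correction by the empty tuple.\<close>

lemma obj_tuple_union:
  assumes B: "B \<in> tuples k A" and D: "D \<in> tuples k C" and "A \<inter> C = {}"
  shows "obj G (tuple_union B D) + obj G (replicate k {}) = obj G B + obj G D"
proof -
  have len: "length B = k" "length D = k" using B D by (auto simp: tuplesD(1))
  have "weight G (v, {i. i < length (tuple_union B D) \<and> v \<in> tuple_union B D ! i})
      + weight G (v, {i. i < length (replicate k {}) \<and> v \<in> replicate k {} ! i})
      = weight G (v, {i. i < length B \<and> v \<in> B ! i}) + weight G (v, {i. i < length D \<and> v \<in> D ! i})"
    for v
  proof -
    have un: "{i. i < length (tuple_union B D) \<and> v \<in> tuple_union B D ! i}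
        = {i. i < length B \<and> v \<in> B ! i} \<union> {i. i < length D \<and> v \<in> D ! i}"
      by (auto simp: len)
    have empty: "{i. i < length (replicate k {}) \<and> v \<in> replicate k {} ! i} = {}"
      by auto
    have "{i. i < length B \<and> v \<in> B ! i} = {} \<or> {i. i < length D \<and> v \<in> D ! i} = {}"
      using assms(3) tuplesD(2)[OF B] tuplesD(2)[OF D] unfolding len by blast
    then show ?thesis
      unfolding un empty by (elim disjE) (simp_all only: Un_empty_left Un_empty_right add.commute)
  qed
  then show ?thesis
    by (simp add: obj_def sum.distrib[symmetric])
qed

lemma dominates_tuple_union:
  assumes 1: "dominates k \<P> G A1 \<C>1 (tuples k A1)" "\<C>1 \<subseteq> tuples k A1"
    and 2: "dominates k \<P> G A2 \<C>2 (tuples k A2)" "\<C>2 \<subseteq> tuples k A2"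
    and A: "A1 \<inter> A2 = {}" "A1 \<subseteq> verts G" "A2 \<subseteq> verts G"
  shows "dominates k \<P> G (A1 \<union> A2) (case_prod tuple_union ` (\<C>1 \<times> \<C>2)) (tuples k (A1 \<union> A2))"
  unfolding dominates_def
proof (intro ballI impI)
  fix D B assume D: "D \<in> tuples k (verts G - (A1 \<union> A2))" and B: "B \<in> tuples k (A1 \<union> A2)"
    and sol: "tuple_union B D \<in> \<P> G"
  define B1 B2 where "B1 = map (\<lambda>X. X \<inter> A1) B" and "B2 = map (\<lambda>X. X \<inter> A2) B"
  have B1: "B1 \<in> tuples k A1" and B2: "B2 \<in> tuples k A2"
    using B by (auto simp: B1_def B2_def tuples_def)
  have B12: "B = tuple_union B1 B2"
  proof (rule nth_equalityI)
    fix i assume "i < length B"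
    then show "B ! i = tuple_union B1 B2 ! i"
      using tuplesD(2)[OF B, of i] tuplesD(1)[OF B] by (auto simp: B1_def B2_def)
  qed (simp add: B1_def B2_def)
  \<comment> \<open>Seen from the left part, the still unchanged right part belongs to the
    context.\<close>
  have "tuple_union B2 D \<in> tuples k (verts G - A1)"
    by (rule tuple_union_in_tuples[OF B2 D]) (use A in auto)
  moreover have "tuple_union B1 (tuple_union B2 D) \<in> \<P> G"
    using sol unfolding B12 tuple_union_assoc .
  ultimately obtain C1 where C1: "C1 \<in> \<C>1" "tuple_union C1 (tuple_union B2 D) \<in> \<P> G"
      "obj G B1 \<le> obj G C1"
    using 1(1) B1 unfolding dominates_def by blast
  have C1': "C1 \<in> tuples k A1" using C1 1(2) by auto
  \<comment> \<open>Seen from the right part, the context already contains the replacement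
    \<open>C1\<close>.\<close>
  have "tuple_union C1 D \<in> tuples k (verts G - A2)"
    by (rule tuple_union_in_tuples[OF C1' D]) (use A in auto)
  moreover have "tuple_union B2 (tuple_union C1 D) \<in> \<P> G"
    using C1(2) by (metis tuple_union_assoc tuple_union_commute)
  ultimately obtain C2 where C2: "C2 \<in> \<C>2" "tuple_union C2 (tuple_union C1 D) \<in> \<P> G"
      "obj G B2 \<le> obj G C2"
    using 2(1) B2 unfolding dominates_def by blast
  have C2': "C2 \<in> tuples k A2" using C2 2(2) by auto
  have "tuple_union (tuple_union C1 C2) D \<in> \<P> G"
    using C2(2) by (metis tuple_union_assoc tuple_union_commute)
  \<comment> \<open>The correction by the empty tuple is the same in both identities and
    cancels.\<close>
  moreover have "obj G B \<le> obj G (tuple_union C1 C2)"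
    using obj_tuple_union[OF B1 B2 A(1), of G] obj_tuple_union[OF C1' C2' A(1), of G] C1(3) C2(3)
    unfolding B12 by linarith
  ultimately show "\<exists>C \<in> case_prod tuple_union ` (\<C>1 \<times> \<C>2). tuple_union C D \<in> \<P> G \<and> obj G B \<le> obj G C"
    using C1(1) C2(1) by auto
qed

text \<open>At the root the context is a tuple over the empty set, that is
  \<open>replicate k {}\<close>, and union with it changes nothing; domination then compares
  solutions directly.\<close>

lemma dominates_optimal:
  assumes "dominates k \<P> G (verts G) \<C> (tuples k (verts G))" and "\<C> \<subseteq> tuples k (verts G)"
    and "\<P> G \<subseteq> tuples k (verts G)" and "\<P> G \<noteq> {}"
  shows "\<exists>B \<in> \<C>. optimal_solution \<P> G B"
proof -
  have fin: "finite (\<P> G)"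
    using assms(3) by (rule finite_subset) (simp add: finite_tuples verts_def)
  have un: "tuple_union B (replicate k {}) = B" if "B \<in> tuples k (verts G)" for B
    using tuplesD(1)[OF that] by (auto intro: nth_equalityI)
  have "Max (obj G ` \<P> G) \<in> obj G ` \<P> G"
    using fin assms(4) by (intro Max_in) auto
  then obtain B where B: "B \<in> \<P> G" "obj G B = Max (obj G ` \<P> G)" by auto
  have "replicate k {} \<in> tuples k (verts G - verts G)"
    by (auto intro: tuplesI)
  then obtain C where C: "C \<in> \<C>" "tuple_union C (replicate k {}) \<in> \<P> G" "obj G B \<le> obj G C"
    using assms(1) B(1) assms(3) un unfolding dominates_def by (metis subsetD)
  have "C \<in> \<P> G" using C assms(2) un by auto
  moreover have "obj G C \<le> Max (obj G ` \<P> G)"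
    using fin \<open>C \<in> \<P> G\<close> by simp
  ultimately show ?thesis
    using C B by (auto simp: optimal_solution_def)
qed

lemma tuples_singleton: "tuples k {v} = set (all_tuples {} {v} k)"
  by (auto simp: tuples_def set_all_tuples subset_singleton_iff)

section \<open>Subtrees and maxima over a layout\<close>

lemma leaves_nonempty: "leaves x \<noteq> []"
  by (induction x) auto

lemma subtrees_self: "x \<in> subtrees x"
  by (cases x) auto

lemma leaves_subtrees: "y \<in> subtrees x \<Longrightarrow> set (leaves y) \<subseteq> set (leaves x)"
  by (induction x) auto

lemma finite_subtrees: "finite (subtrees x)"
  by (induction x) auto

lemma layout_max_ge: "x \<in> subtrees L \<Longrightarrow> g G (set (leaves x)) \<le> layout_max g G L"
  unfolding layout_max_def by (intro Max_ge) (auto simp: finite_subtrees)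

section \<open>Recursion over the layout\<close>

definition good_family :: "nat \<Rightarrow> problem \<Rightarrow> wgraph \<Rightarrow> nat \<Rightarrow> nat set \<Rightarrow> nat set list list \<Rightarrow> bool" where
  "good_family k \<P> G S A Cs \<longleftrightarrow> distinct Cs \<and> set Cs \<subseteq> tuples k A \<and> length Cs \<le> S \<and>
     dominates k \<P> G A (set Cs) (tuples k A)"

text \<open>The routine is not called on the empty family, where its running time is unbounded.\<close>

definition reduce_step :: "nat \<Rightarrow> com" where
  "reduce_step q =
     Seq (If (IsPair (reg 4))
            (Call (Lit 4) q (MkPair (Fst (Fst (reg 0))) (mk_triple (Snd (Fst (reg 0))) (reg 3) (reg 4))))
            Skip)
         (Assign (Lit 0) (MkPair (reg 3) (reg 4)))"

text \<open>Formulated for any register contents that agree on three registers, since leaves and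
  internal nodes reach this code with different leftovers elsewhere.\<close>

lemma wp_reduce_step:
  assumes "\<sigma> 0 = Pair (Pair (enc_graph k G) (enc_matrix (order G) (\<lambda>u v. enc_enat (gdist G u v)))) l"
    and "\<sigma> 3 = enc_set (order G) A" and "\<sigma> 4 = enc_family (order G) Bs"
    and q: "Bs \<noteq> [] \<Longrightarrow> calls \<Gamma> q (reduce_input k G A Bs) (enc_family (order G) Cs) T"
    and "Bs = [] \<Longrightarrow> Cs = []"
    and Q: "\<And>\<sigma>' t. \<sigma>' 0 = Pair (enc_set (order G) A) (enc_family (order G) Cs) \<Longrightarrow> t \<le> T + 60 \<Longrightarrow> Q \<sigma>' t"
  shows "wp \<Gamma> (reduce_step q) \<sigma> Q"
proof (cases Bs)
  case Nil
  then show ?thesis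
    unfolding reduce_step_def
    by (intro wp_intros) (use assms(1-3,5) in \<open>auto simp: enc_family_def intro!: Q\<close>)
next
  case (Cons B Bs')
  then have "calls \<Gamma> q (reduce_input k G A Bs) (enc_family (order G) Cs) T"
    using q by simp
  note q' = wp_Call[OF this]
  show ?thesis
    unfolding reduce_step_def
    by (intro wp_intros q')
       (use assms(1-3) in \<open>auto simp: Cons enc_family_def reduce_input_def intro!: Q\<close>)
qed

text \<open>The input is \<open>((graph, distances), layout)\<close>, the output \<open>(V\<^sub>x, family)\<close>. The adjacency matrix
  serves as a list of length \<open>n\<close> when incidence vectors are built, and the key \<open>-1\<close> yields the empty set.\<close>

definition solve_body :: "nat \<Rightarrow> nat \<Rightarrow> nat \<Rightarrow> nat \<Rightarrow> nat \<Rightarrow> nat \<Rightarrow> com" where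
  "solve_body p u c sg al q = Seq
     (If (IsPair (Snd (reg 0)))
       (Seq (Call (Lit 1) p (MkPair (Fst (reg 0)) (Fst (Snd (reg 0)))))
       (Seq (Call (Lit 2) p (MkPair (Fst (reg 0)) (Snd (Snd (reg 0)))))
       (Seq (Call (Lit 3) u (mk_triple (Lit 0) (Fst (reg 1)) (Fst (reg 2))))
            (Call (Lit 4) c (MkPair (Snd (reg 1)) (Snd (reg 2)))))))
       (Seq (Call (Lit 5) sg (mk_triple (Lit (-1)) (Lit 0) (Fst (Snd (Snd (Fst (Fst (reg 0))))))))
       (Seq (Call (Lit 3) sg (mk_triple (Snd (reg 0)) (Lit 0) (Fst (Snd (Snd (Fst (Fst (reg 0))))))))
            (Call (Lit 4) al (mk_triple (Fst (Snd (Fst (Fst (reg 0))))) (reg 5) (reg 3))))))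
     (reduce_step q)"

text \<open>The summands are two incidence vectors, the enumeration, the routine on
  \<open>2^k\<close> tuples, and straight-line overhead. The right side is shared with internal
  nodes, so that every node can be charged the same amount.\<close>

lemma leaf_cost:
  fixes n k S F :: nat
  assumes "1 \<le> n" "1 \<le> k" "1 \<le> S"
  shows "160 * (n + 1) + 150 * 2 ^ k + F * 2 ^ k + 260 \<le> 2500 * (2 ^ k * k * S\<^sup>2 * (n + F))"
proof -
  \<comment> \<open>The nonlinear terms are replaced by variables, which leaves a linear
    inequality.\<close>
  have lin: "160 * (n + 1) + 150 * a + y + 260 \<le> 2500 * (x + y)" if "n \<le> x" "a \<le> x" for a x y
    using that assms(1) by (simp add: algebra_simps)
  have "160 * (n + 1) + 150 * 2 ^ k + 2 ^ k * F + 260 \<le> 2500 * (2 ^ k * n + 2 ^ k * F)"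
    by (rule lin) (use assms in simp_all)
  also have "\<dots> \<le> 2500 * (2 ^ k * n + 2 ^ k * F) * (k * S\<^sup>2)"
    using assms by simp
  finally show ?thesis by (simp add: algebra_simps)
qed

text \<open>This case determines the constant: with \<open>n \<ge> 1\<close> the terms other than
  the call of the routine add up to 140 + 2020 + 260 = 2420 units of
  \<open>k * n * S^2\<close>.\<close>

lemma node_cost:
  fixes n k S F :: nat
  assumes "1 \<le> n" "1 \<le> k" "1 \<le> S"
  shows "70 * (n + 1) + 2020 * (k * n * S\<^sup>2) + F * S\<^sup>2 + 260 \<le> 2500 * (2 ^ k * k * S\<^sup>2 * (n + F))"
proof -
  have lin: "70 * (n + 1) + 2020 * x + z + 260 \<le> 2500 * (x + y)" if "n \<le> x" "z \<le> y" for x y z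
    using that assms(1) by (simp add: algebra_simps)
  have "70 * (n + 1) + 2020 * (k * n * S\<^sup>2) + F * S\<^sup>2 + 260 \<le> 2500 * (k * n * S\<^sup>2 + k * F * S\<^sup>2)"
    by (rule lin) (use assms in simp_all)
  also have "\<dots> \<le> 2500 * (k * n * S\<^sup>2 + k * F * S\<^sup>2) * 2 ^ k"
    by simp
  finally show ?thesis by (simp add: algebra_simps)
qed

text \<open>There are at most \<open>S^2\<close> pairs, each needing \<open>k\<close> unions of
  vectors of length \<open>n\<close>. Positivity bounds each successor by a double: 430 units per
  pair become 860 with the row overhead, plus 150 for appending, and the outer list doubles 1010 to
  2020.\<close>

lemma calls_family_product:
  fixes n k S :: nat
  assumes c: "proc_at \<Gamma> c (product_body c r a)" and a: "proc_at \<Gamma> a (append_body a)"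
    and r: "proc_at \<Gamma> r (map_body r t)" and t: "proc_at \<Gamma> t (zip_body t u)"
    and u: "\<And>A B. calls \<Gamma> u (Pair (Num 0) (Pair (enc_set n A) (enc_set n B))) (enc_set n (A \<union> B)) (70 * (n + 1))"
    and len: "\<And>B. B \<in> set Bs \<union> set Ds \<Longrightarrow> length B = k"
    and S: "length Bs \<le> S" "length Ds \<le> S" and pos: "1 \<le> n" "1 \<le> k" "1 \<le> S"
  shows "calls \<Gamma> c (Pair (enc_family n Bs) (enc_family n Ds))
           (enc_family n (map (case_prod tuple_union) (List.product Bs Ds))) (2020 * (k * n * S\<^sup>2))"
proof -
  let ?g = "enc_list (enc_set n)"
  let ?T = "(70 * (n + 1) + 50) * (k + 1)"
  have 1: "calls \<Gamma> r (Pair (Num 0) (Pair (?g B) (enc_list ?g Ds))) (enc_list ?g (map (tuple_union B) Ds))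
      ((?T + 50) * (length Ds + 1))" if "B \<in> set Bs" for B
    unfolding enc_list_map
    by (rule calls_map[OF r calls_tuple_union[OF t u]]) (use len that in auto)
  have "calls \<Gamma> c (Pair (enc_list ?g Bs) (enc_list ?g Ds))
      (enc_list ?g (map (case_prod tuple_union) (List.product Bs Ds)))
      (((?T + 50) * (length Ds + 1) + 50 * (length Ds + 2)) * (length Bs + 1))"
    by (rule calls_product[OF c a 1])
  then show ?thesis
    unfolding enc_family_def
  proof (rule calls_mono)
    have "1 \<le> k * n" using pos by simp
    have "?T \<le> (190 * n) * (2 * k)"
      by (rule mult_mono) (use pos in auto)
    then have T: "?T + 50 \<le> 430 * (k * n)"
      using \<open>1 \<le> k * n\<close> by (simp add: algebra_simps)
    have "(?T + 50) * (length Ds + 1) \<le> 430 * (k * n) * (2 * S)"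
      by (rule mult_mono[OF T]) (use S pos in auto)
    moreover have "50 * (length Ds + 2) \<le> 150 * S"
      using S pos by simp
    moreover have "150 * S \<le> 150 * (k * n * S)"
      using \<open>1 \<le> k * n\<close> by simp
    ultimately have "(?T + 50) * (length Ds + 1) + 50 * (length Ds + 2) \<le> 1010 * (k * n * S)"
      by linarith
    then have "((?T + 50) * (length Ds + 1) + 50 * (length Ds + 2)) * (length Bs + 1)
        \<le> 1010 * (k * n * S) * (2 * S)"
      by (rule mult_mono) (use S pos in auto)
    then show "((?T + 50) * (length Ds + 1) + 50 * (length Ds + 2)) * (length Bs + 1)
        \<le> 2020 * (k * n * S\<^sup>2)"
      by (simp add: power2_eq_square algebra_simps)
  qed
qed

text \<open>A binary tree with m leaves has 2m - 1 nodes, each charged \<open>W\<close>. The routine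
  is assumed to act well only on nonempty families that already dominate all tuples, which is what
  the induction can guarantee.\<close>

lemma calls_solve:
  fixes G :: wgraph and n k S F :: nat
  defines "n \<equiv> order G" and "W \<equiv> 2500 * (2 ^ k * k * S\<^sup>2 * (n + F))"
  assumes p: "proc_at \<Gamma> p (solve_body p u c sg al q)"
    and u: "\<And>A B. calls \<Gamma> u (Pair (Num 0) (Pair (enc_set n A) (enc_set n B))) (enc_set n (A \<union> B)) (70 * (n + 1))"
    and c: "\<And>Bs Ds. (\<And>B. B \<in> set Bs \<union> set Ds \<Longrightarrow> length B = k) \<Longrightarrow> length Bs \<le> S \<Longrightarrow> length Ds \<le> S \<Longrightarrow>
      calls \<Gamma> c (Pair (enc_family n Bs) (enc_family n Ds))
        (enc_family n (map (case_prod tuple_union) (List.product Bs Ds))) (2020 * (k * n * S\<^sup>2))"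
    and sg: "\<And>i g. calls \<Gamma> sg (Pair (Num i) (Pair (Num 0) (enc_list g [0..<n]))) (enc_set n {v. i = int v}) (80 * (n + 1))"
    and al: "\<And>A B. calls \<Gamma> al (Pair (Num (int k)) (Pair (enc_set n A) (enc_set n B)))
        (enc_family n (all_tuples A B k)) (150 * 2 ^ k)"
    and q: "\<And>y Bs. y \<in> subtrees x \<Longrightarrow> reduce_instance k G (set (leaves y)) Bs \<Longrightarrow> Bs \<noteq> [] \<Longrightarrow>
      dominates k \<P> G (set (leaves y)) (set Bs) (tuples k (set (leaves y))) \<Longrightarrow>
      \<exists>Cs. calls \<Gamma> q (reduce_input k G (set (leaves y)) Bs) (enc_family n Cs) (F * length Bs) \<and>
        good_family k \<P> G S (set (leaves y)) Cs"
    and G: "weighted_graph k G" and x: "distinct (leaves x)" "set (leaves x) \<subseteq> verts G"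
    and pos: "1 \<le> n" "1 \<le> k" "1 \<le> S"
  shows "\<exists>Cs. calls \<Gamma> p
      (Pair (Pair (enc_graph k G) (enc_matrix n (\<lambda>u v. enc_enat (gdist G u v)))) (enc_layout x))
      (Pair (enc_set n (set (leaves x))) (enc_family n Cs)) (W * (2 * length (leaves x) - 1)) \<and>
      good_family k \<P> G S (set (leaves x)) Cs"
  using q x
proof (induction x)
  case (Leaf v)
  let ?Bs = "all_tuples {} {v} k"
  have len: "length ?Bs = 2 ^ k" by (rule length_all_tuples)
  have ne: "?Bs \<noteq> []" using len by (metis length_0_conv power_not_zero zero_neq_numeral)
  have "reduce_instance k G {v} ?Bs"
    using G Leaf.prems by (simp add: reduce_instance_def tuples_singleton distinct_all_tuples)
  moreover have "dominates k \<P> G {v} (set ?Bs) (tuples k {v})"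
    unfolding tuples_singleton dominates_def by auto
  ultimately obtain Cs where call: "calls \<Gamma> q (reduce_input k G {v} ?Bs) (enc_family n Cs) (F * 2 ^ k)"
    and Cs: "good_family k \<P> G S {v} Cs"
    using Leaf.prems(1)[of "Leaf v" ?Bs] ne by (auto simp: len)
  note sg1 = sg[of "-1" "\<lambda>u. enc_list (\<lambda>v. enc_bool ({u, v} \<in> edges G)) [0..<n]"]
    and sg2 = sg[of "int v" "\<lambda>u. enc_list (\<lambda>v. enc_bool ({u, v} \<in> edges G)) [0..<n]"]
  have sets: "{w. - 1 = int w} = {}" "{w. int v = int w} = {v}" by auto
  note cost = leaf_cost[OF pos, of F, folded W_def]
  have red: "wp \<Gamma> (reduce_step q) \<sigma> Q"
    if "\<sigma> 0 = Pair (Pair (enc_graph k G) (enc_matrix n (\<lambda>u v. enc_enat (gdist G u v)))) (enc_layout (Leaf v))"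
      "\<sigma> 3 = enc_set n {v}" "\<sigma> 4 = enc_family n ?Bs"
      "\<And>\<sigma>' t. \<sigma>' 0 = Pair (enc_set n {v}) (enc_family n Cs) \<Longrightarrow> t \<le> F * 2 ^ k + 60 \<Longrightarrow> Q \<sigma>' t"
    for \<sigma> Q
    by (rule wp_reduce_step[OF that(1-3)[unfolded n_def] call[unfolded n_def] _ that(4)[unfolded n_def]]) (use ne in simp_all)
  show ?case
  proof (intro exI conjI)
    show "good_family k \<P> G S (set (leaves (Leaf v))) Cs" using Cs by simp
    show "calls \<Gamma> p (Pair (Pair (enc_graph k G) (enc_matrix n (\<lambda>u v. enc_enat (gdist G u v)))) (enc_layout (Leaf v)))
      (Pair (enc_set n (set (leaves (Leaf v)))) (enc_family n Cs)) (W * (2 * length (leaves (Leaf v)) - 1))"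
      using cost ne
      by - (rule callsI[OF p], unfold solve_body_def,
          intro wp_intros wp_Call[OF sg1[unfolded sets]] wp_Call[OF sg2[unfolded sets]]
            wp_Call[OF al[of "{}" "{v}"]] red;
        auto simp: init_regs_def enc_graph_def enc_matrix_def n_def[symmetric])
  qed
next
  case (Node l r)
  let ?A = "set (leaves l)" and ?B = "set (leaves r)"
  have disj: "?A \<inter> ?B = {}" "?A \<subseteq> verts G" "?B \<subseteq> verts G"
    and dist: "distinct (leaves l)" "distinct (leaves r)"
    using Node.prems by auto
  obtain Ls where Ls: "calls \<Gamma> p
      (Pair (Pair (enc_graph k G) (enc_matrix n (\<lambda>u v. enc_enat (gdist G u v)))) (enc_layout l))
      (Pair (enc_set n ?A) (enc_family n Ls)) (W * (2 * length (leaves l) - 1))"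
      "good_family k \<P> G S ?A Ls"
    using Node.IH(1)[OF Node.prems(1) dist(1) disj(2)] by auto
  obtain Rs where Rs: "calls \<Gamma> p
      (Pair (Pair (enc_graph k G) (enc_matrix n (\<lambda>u v. enc_enat (gdist G u v)))) (enc_layout r))
      (Pair (enc_set n ?B) (enc_family n Rs)) (W * (2 * length (leaves r) - 1))"
      "good_family k \<P> G S ?B Rs"
    using Node.IH(2)[OF Node.prems(1) dist(2) disj(3)] by auto
  let ?Bs = "map (case_prod tuple_union) (List.product Ls Rs)"
  have L: "distinct Ls" "set Ls \<subseteq> tuples k ?A" "length Ls \<le> S" "dominates k \<P> G ?A (set Ls) (tuples k ?A)"
    and R: "distinct Rs" "set Rs \<subseteq> tuples k ?B" "length Rs \<le> S" "dominates k \<P> G ?B (set Rs) (tuples k ?B)"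
    using Ls(2) Rs(2) by (auto simp: good_family_def)
  have prod: "calls \<Gamma> c (Pair (enc_family n Ls) (enc_family n Rs)) (enc_family n ?Bs) (2020 * (k * n * S\<^sup>2))"
    by (rule c) (use L R tuplesD(1) in blast)+
  have "inj_on (case_prod tuple_union) (set (List.product Ls Rs))"
    by (rule inj_on_subset[OF inj_on_tuple_union[OF disj(1)]]) (use L R in auto)
  then have "distinct ?Bs"
    using L(1) R(1) by (simp add: distinct_map distinct_product)
  moreover have "set ?Bs \<subseteq> tuples k (?A \<union> ?B)"
    using L(2) R(2) by (auto intro!: tuple_union_in_tuples[of _ k ?A _ ?B])
  ultimately have inst: "reduce_instance k G (set (leaves (Node l r))) ?Bs"
    using G disj by (simp add: reduce_instance_def)
  have dom: "dominates k \<P> G (set (leaves (Node l r))) (set ?Bs) (tuples k (set (leaves (Node l r))))"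
    using dominates_tuple_union[OF L(4,2) R(4,2) disj] by simp
  have len: "length ?Bs \<le> S\<^sup>2"
    using mult_mono[OF L(3) R(3)] by (simp add: power2_eq_square)
  obtain Cs where call: "?Bs \<noteq> [] \<Longrightarrow>
        calls \<Gamma> q (reduce_input k G (set (leaves (Node l r))) ?Bs) (enc_family n Cs) (F * S\<^sup>2)"
      and nil: "?Bs = [] \<Longrightarrow> Cs = []" and Cs: "good_family k \<P> G S (set (leaves (Node l r))) Cs"
  proof (cases "?Bs = []")
    case True
    \<comment> \<open>That the empty family dominates means that no tuple over these vertices
      extends to a solution, so the skipped call leaves a correct result.\<close>
    have "good_family k \<P> G S (set (leaves (Node l r))) []"
      using dom unfolding good_family_def True by simp
    with True that show ?thesis by blast
  next
    case False
    obtain Cs where "calls \<Gamma> q (reduce_input k G (set (leaves (Node l r))) ?Bs) (enc_family n Cs) (F * length ?Bs)"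
      "good_family k \<P> G S (set (leaves (Node l r))) Cs"
      using Node.prems(1)[OF _ inst False dom] by (auto simp: subtrees_self)
    moreover have "F * length ?Bs \<le> F * S\<^sup>2" using len by (rule mult_le_mono2)
    ultimately show ?thesis using that False calls_mono by blast
  qed
  note cost = node_cost[OF pos, of F, folded W_def]
  have red: "wp \<Gamma> (reduce_step q) \<sigma> Q"
    if "\<sigma> 0 = Pair (Pair (enc_graph k G) (enc_matrix n (\<lambda>u v. enc_enat (gdist G u v)))) (enc_layout (Node l r))"
      "\<sigma> 3 = enc_set n (?A \<union> ?B)" "\<sigma> 4 = enc_family n ?Bs"
      "\<And>\<sigma>' t. \<sigma>' 0 = Pair (enc_set n (?A \<union> ?B)) (enc_family n Cs) \<Longrightarrow> t \<le> F * S\<^sup>2 + 60 \<Longrightarrow> Q \<sigma>' t"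
    for \<sigma> Q
    by (rule wp_reduce_step[OF that(1-3)[unfolded n_def] call[unfolded n_def leaves.simps set_append] nil that(4)[unfolded n_def]])
  \<comment> \<open>Nonempty leaf lists make the natural subtraction exact: (2a + 1) + (2b + 1) + 1
    = 2(a + b + 2) - 1.\<close>
  obtain a b where ab: "length (leaves l) = Suc a" "length (leaves r) = Suc b"
    by (metis leaves_nonempty length_0_conv not0_implies_Suc)
  show ?case
  proof (intro exI conjI)
    show "good_family k \<P> G S (set (leaves (Node l r))) Cs" by (rule Cs)
    show "calls \<Gamma> p (Pair (Pair (enc_graph k G) (enc_matrix n (\<lambda>u v. enc_enat (gdist G u v)))) (enc_layout (Node l r)))
      (Pair (enc_set n (set (leaves (Node l r)))) (enc_family n Cs)) (W * (2 * length (leaves (Node l r)) - 1))"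
      using cost
      by - (rule callsI[OF p], unfold solve_body_def,
          intro wp_intros wp_Call[OF Ls(1)] wp_Call[OF Rs(1)] wp_Call[OF u[of ?A ?B]] wp_Call[OF prod] red;
        auto simp: init_regs_def ab algebra_simps)
  qed
qed

section \<open>The main program\<close>

definition main_body :: "nat \<Rightarrow> nat \<Rightarrow> nat \<Rightarrow> com" where
  "main_body i w p =
     Seq (Call (Lit 1) i (mk_triple (Lit 0) (Lit 0) (Fst (Snd (Snd (Fst (reg 0)))))))
    (Seq (Call (Lit 2) w (mk_triple (Lit 0) (Fst (Fst (reg 0))) (reg 1)))
    (Seq (Call (Lit 3) p (MkPair (MkPair (Fst (reg 0)) (reg 2)) (Snd (reg 0))))
         (Assign (Lit 0) (Snd (reg 3)))))"

text \<open>Call indices are absolute, hence the offset \<open>b\<close>, the number of procedures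
  placed before this block; \<open>q\<close> is the entry point of the reduce routine.\<close>

definition layout_procs :: "nat \<Rightarrow> nat \<Rightarrow> com list" where
  "layout_procs b q =
    [or_body, zip_body (b + 1) b, zip_body (b + 2) (b + 1), map_body (b + 3) (b + 2),
     append_body (b + 4), product_body (b + 5) (b + 3) (b + 4),
     eq_body, mapi_body (b + 7) (b + 6), cons_either_body (b + 8), all_tuples_body (b + 9) (b + 8),
     nth_body (b + 10), relax_entry_body, zip_body (b + 12) (b + 11), relax_row_body (b + 10) (b + 12),
     map_body (b + 14) (b + 13), fw_body (b + 15) (b + 10) (b + 14),
     init_entry_body, mapi_body (b + 17) (b + 16), init_row_body (b + 17), mapi_body (b + 19) (b + 18),
     solve_body (b + 20) (b + 1) (b + 5) (b + 7) (b + 9) q, main_body (b + 19) (b + 15) (b + 20)]"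

lemma proc_at_append: "i < length \<Delta> \<Longrightarrow> proc_at (\<Gamma> @ \<Delta>) (length \<Gamma> + i) (\<Delta> ! i)"
  by (simp add: proc_at_def)

lemma layout_program_correct:
  fixes G :: wgraph and R :: program and k S F :: nat
  defines "n \<equiv> order G" and "b \<equiv> length (fst R)"
  defines "\<Gamma> \<equiv> fst R @ layout_procs b (snd R)"
  assumes q: "\<And>y Bs. y \<in> subtrees L \<Longrightarrow> reduce_instance k G (set (leaves y)) Bs \<Longrightarrow> Bs \<noteq> [] \<Longrightarrow>
      dominates k \<P> G (set (leaves y)) (set Bs) (tuples k (set (leaves y))) \<Longrightarrow>
      \<exists>Cs. calls \<Gamma> (snd R) (reduce_input k G (set (leaves y)) Bs) (enc_family n Cs) (F * length Bs) \<and>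
        good_family k \<P> G S (set (leaves y)) Cs"
    and G: "weighted_graph k G" and L: "rooted_layout G L" and pos: "1 \<le> k" "1 \<le> S"
  shows "\<exists>Cs. calls \<Gamma> (b + 21) (algorithm_input k G L) (enc_family n Cs)
      (5000 * (2 ^ k * k * S\<^sup>2 * (n + F)) * n + 4100 * n ^ 3) \<and> good_family k \<P> G S (verts G) Cs"
proof -
  have procs: "i < 22 \<Longrightarrow> proc_at \<Gamma> (b + i) (layout_procs b (snd R) ! i)" for i
    unfolding \<Gamma>_def b_def by (rule proc_at_append) (simp add: layout_procs_def)
  have at:
    "proc_at \<Gamma> b or_body"
    "proc_at \<Gamma> (b + 1) (zip_body (b + 1) b)"
    "proc_at \<Gamma> (b + 2) (zip_body (b + 2) (b + 1))"
    "proc_at \<Gamma> (b + 3) (map_body (b + 3) (b + 2))"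
    "proc_at \<Gamma> (b + 4) (append_body (b + 4))"
    "proc_at \<Gamma> (b + 5) (product_body (b + 5) (b + 3) (b + 4))"
    "proc_at \<Gamma> (b + 6) eq_body"
    "proc_at \<Gamma> (b + 7) (mapi_body (b + 7) (b + 6))"
    "proc_at \<Gamma> (b + 8) (cons_either_body (b + 8))"
    "proc_at \<Gamma> (b + 9) (all_tuples_body (b + 9) (b + 8))"
    "proc_at \<Gamma> (b + 10) (nth_body (b + 10))"
    "proc_at \<Gamma> (b + 11) relax_entry_body"
    "proc_at \<Gamma> (b + 12) (zip_body (b + 12) (b + 11))"
    "proc_at \<Gamma> (b + 13) (relax_row_body (b + 10) (b + 12))"
    "proc_at \<Gamma> (b + 14) (map_body (b + 14) (b + 13))"
    "proc_at \<Gamma> (b + 15) (fw_body (b + 15) (b + 10) (b + 14))"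
    "proc_at \<Gamma> (b + 16) init_entry_body"
    "proc_at \<Gamma> (b + 17) (mapi_body (b + 17) (b + 16))"
    "proc_at \<Gamma> (b + 18) (init_row_body (b + 17))"
    "proc_at \<Gamma> (b + 19) (mapi_body (b + 19) (b + 18))"
    "proc_at \<Gamma> (b + 20) (solve_body (b + 20) (b + 1) (b + 5) (b + 7) (b + 9) (snd R))"
    "proc_at \<Gamma> (b + 21) (main_body (b + 19) (b + 15) (b + 20))"
        using procs[of 0] procs[of 1] procs[of 2] procs[of 3] procs[of 4] procs[of 5] procs[of 6]
      procs[of 7] procs[of 8] procs[of 9] procs[of 10] procs[of 11] procs[of 12] procs[of 13]
      procs[of 14] procs[of 15] procs[of 16] procs[of 17] procs[of 18] procs[of 19] procs[of 20]
      procs[of 21]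
    by (simp_all add: layout_procs_def)
  have dL: "distinct (leaves L)" and vL: "set (leaves L) = verts G"
    using L by (auto simp: rooted_layout_def)
  then have len: "length (leaves L) = n"
    using distinct_card[OF dL] by (simp add: verts_def n_def)
  with leaves_nonempty[of L] have n: "1 \<le> n"
    by (metis One_nat_def Suc_leI length_greater_0_conv)
  have u: "calls \<Gamma> (b + 1) (Pair (Num 0) (Pair (enc_set n A) (enc_set n B))) (enc_set n (A \<union> B)) (70 * (n + 1))" for A B
    by (rule calls_union[OF at(1,2)])
  have c: "calls \<Gamma> (b + 5) (Pair (enc_family n Bs) (enc_family n Ds))
        (enc_family n (map (case_prod tuple_union) (List.product Bs Ds))) (2020 * (k * n * S\<^sup>2))"
    if "\<And>B. B \<in> set Bs \<union> set Ds \<Longrightarrow> length B = k" "length Bs \<le> S" "length Ds \<le> S" for Bs Ds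
    by (rule calls_family_product[OF at(6,5,4,3) u that n pos])
  have sg: "calls \<Gamma> (b + 7) (Pair (Num i) (Pair (Num 0) (enc_list g [0..<n]))) (enc_set n {v. i = int v}) (80 * (n + 1))" for i g
    by (rule calls_singleton[OF at(7,8)])
  have al: "calls \<Gamma> (b + 9) (Pair (Num (int k)) (Pair (enc_set n A) (enc_set n B)))
        (enc_family n (all_tuples A B k)) (150 * 2 ^ k)" for A B
    unfolding enc_family_def by (rule calls_all_tuples[OF at(10,9)])
  obtain Cs where solve: "calls \<Gamma> (b + 20)
      (Pair (Pair (enc_graph k G) (enc_matrix n (\<lambda>u v. enc_enat (gdist G u v)))) (enc_layout L))
      (Pair (enc_set n (verts G)) (enc_family n Cs)) (2500 * (2 ^ k * k * S\<^sup>2 * (n + F)) * (2 * n - 1))"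
    and Cs: "good_family k \<P> G S (verts G) Cs"
    using calls_solve[of \<Gamma> "b + 20" "b + 1" "b + 5" "b + 7" "b + 9" "snd R" G k S L \<P> F, folded n_def,
        OF at(21) u c sg al q G dL equalityD1[OF vL] n pos]
    unfolding vL len by blast
  note init = calls_init_matrix[OF at(17-20), of n G]
  have fw: "calls \<Gamma> (b + 15) (Pair (Num 0) (Pair (Num (int n)) (enc_matrix n (\<lambda>u v. enc_enat (walk_dist G 0 u v)))))
      (enc_matrix n (\<lambda>u v. enc_enat (gdist G u v))) (400 * (n + 1)\<^sup>2 * (n + 1))"
    using calls_fw[OF at(12,13,11,14-16), of 0 n n G] walk_dist_order[OF G] by (simp add: n_def)
  have "calls \<Gamma> (b + 21) (algorithm_input k G L) (enc_family n Cs)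
     (200 * (n + 1)\<^sup>2 + 400 * (n + 1)\<^sup>2 * (n + 1) + 2500 * (2 ^ k * k * S\<^sup>2 * (n + F)) * (2 * n - 1) + 100)"
    by (rule callsI[OF at(22)], unfold main_body_def,
        intro wp_intros wp_Call[OF init] wp_Call[OF fw] wp_Call[OF solve])
       (auto simp: init_regs_def algorithm_input_def enc_graph_def n_def[symmetric])
  moreover have "200 * (n + 1)\<^sup>2 + 400 * (n + 1)\<^sup>2 * (n + 1) + 2500 * (2 ^ k * k * S\<^sup>2 * (n + F)) * (2 * n - 1) + 100
      \<le> 5000 * (2 ^ k * k * S\<^sup>2 * (n + F)) * n + 4100 * n ^ 3"
  proof -
    have lin: "w + x + y + z \<le> y' + d" if "w + x + z \<le> d" "y \<le> y'" for w x y y' z d :: nat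
      using that by simp
    \<comment> \<open>From n + 1 \<le> 2n the distance computation costs at most 200 * 4 + 400 * 8 +
      100 = 4100 units of \<open>n^3\<close>.\<close>
    have "n ^ 2 \<le> n ^ 3" "1 \<le> n ^ 3" using n by (simp_all add: power_increasing)
    moreover have "(n + 1) ^ 2 \<le> (2 * n) ^ 2" "(n + 1) ^ 3 \<le> (2 * n) ^ 3"
      by (rule power_mono, use n in simp, simp)+
    then have "(n + 1) ^ 2 \<le> 4 * n ^ 2" "(n + 1) ^ 3 \<le> 8 * n ^ 3"
      by (simp_all add: power_mult_distrib)
    moreover have "400 * (n + 1)\<^sup>2 * (n + 1) = 400 * (n + 1) ^ 3"
      by (simp add: power2_eq_square power3_eq_cube algebra_simps)
    ultimately have dist: "200 * (n + 1)\<^sup>2 + 400 * (n + 1)\<^sup>2 * (n + 1) + 100 \<le> 4100 * n ^ 3"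
      by linarith
    have "2500 * (2 ^ k * k * S\<^sup>2 * (n + F)) * (2 * n - 1) \<le> 2500 * (2 ^ k * k * S\<^sup>2 * (n + F)) * (2 * n)"
      by (rule mult_le_mono2) simp
    also have "\<dots> = 5000 * (2 ^ k * k * S\<^sup>2 * (n + F)) * n"
      by simp
    finally show ?thesis
      by (rule lin[OF dist])
  qed
  ultimately show ?thesis using Cs calls_mono by blast
qed

theorem theorem4p5:
  "\<exists>c::real. \<forall>(k::nat) (\<P>::problem) (R::program) s f.
     k \<ge> 1 \<and> k_problem k \<P> \<and> reduce_routine k \<P> R \<and> size_bound k R s \<and> run_time_bound k R f \<longrightarrow>
     (\<exists>P::program. \<forall>G L. weighted_graph k G \<and> rooted_layout G L \<longrightarrow>
       (\<exists>Bs t. runs P (algorithm_input k G L) (enc_family (order G) Bs) t \<and>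
          real t \<le> c * (2 ^ (2 * k) * real k * (layout_max s G L)\<^sup>2 *
                          (layout_max f G L * real (order G) + real (order G) ^ 2) +
                        real (order G) ^ 3) \<and>
          distinct Bs \<and> set Bs \<subseteq> tuples k (verts G) \<and>
          real (length Bs) \<le> layout_max s G L \<and>
          (\<P> G \<noteq> {} \<longrightarrow> (\<exists>B \<in> set Bs. optimal_solution \<P> G B))))"
\<comment> \<open>Twice the 5000 of the program bound: rounding \<open>f\<close> up costs an extra
  \<open>n\<close>, and n^2 + fn + n \<le> 2(fn + n^2).\<close>
proof (intro exI[of _ 10000] allI impI, elim conjE)
  fix k :: nat and \<P> :: problem and R :: program and s f
  assume k: "k \<ge> 1" and kp: "k_problem k \<P>" and rr: "reduce_routine k \<P> R"
    and sb: "size_bound k R s" and tb: "run_time_bound k R f"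
  let ?b = "length (fst R)"
  let ?\<Gamma> = "fst R @ layout_procs ?b (snd R)"
  show "\<exists>P::program. \<forall>G L. weighted_graph k G \<and> rooted_layout G L \<longrightarrow>
       (\<exists>Bs t. runs P (algorithm_input k G L) (enc_family (order G) Bs) t \<and>
          real t \<le> 10000 * (2 ^ (2 * k) * real k * (layout_max s G L)\<^sup>2 *
                          (layout_max f G L * real (order G) + real (order G) ^ 2) +
                        real (order G) ^ 3) \<and>
          distinct Bs \<and> set Bs \<subseteq> tuples k (verts G) \<and>
          real (length Bs) \<le> layout_max s G L \<and>
          (\<P> G \<noteq> {} \<longrightarrow> (\<exists>B \<in> set Bs. optimal_solution \<P> G B)))"
  proof (intro exI[of _ "(?\<Gamma>, ?b + 21)"] allI impI, elim conjE)
    fix G L assume G: "weighted_graph k G" and L: "rooted_layout G L"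
    let ?s = "layout_max s G L" and ?f = "layout_max f G L" and ?n = "order G"
    \<comment> \<open>Rounding down keeps the output within the real bound and loses nothing for
      integral lengths; rounding the time bound up exceeds it by at most one.\<close>
    define S F where "S = nat \<lfloor>?s\<rfloor>" and "F = nat \<lceil>?f\<rceil>"
    have sub: "set (leaves y) \<subseteq> verts G" if "y \<in> subtrees L" for y
      using leaves_subtrees[OF that] L by (simp add: rooted_layout_def)
    have "1 \<le> s G (set (leaves L))"
      using sb G sub[OF subtrees_self] unfolding size_bound_def by blast
    then have s1: "1 \<le> ?s"
      using layout_max_ge[OF subtrees_self, of s G L] by linarith
    then have S: "1 \<le> S" "real S \<le> ?s"
      by (simp_all add: S_def le_nat_floor)
    have run: "\<exists>Cs. calls ?\<Gamma> (snd R) (reduce_input k G (set (leaves y)) Bs) (enc_family ?n Cs) (F * length Bs) \<and>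
        good_family k \<P> G S (set (leaves y)) Cs \<and> 0 \<le> f G (set (leaves y))"
      if y: "y \<in> subtrees L" and inst: "reduce_instance k G (set (leaves y)) Bs" and ne: "Bs \<noteq> []"
        and dom: "dominates k \<P> G (set (leaves y)) (set Bs) (tuples k (set (leaves y)))" for y Bs
    proof -
      let ?A = "set (leaves y)"
      obtain Cs t where Cs: "runs R (reduce_input k G ?A Bs) (enc_family ?n Cs) t"
        "distinct Cs" "set Cs \<subseteq> set Bs" "represents k \<P> G ?A (set Cs) (set Bs)"
        using rr inst unfolding reduce_routine_def by blast
      have "real (length Cs) \<le> s G ?A"
        using sb inst Cs(1) unfolding size_bound_def by blast
      also have "\<dots> \<le> ?s" by (rule layout_max_ge[OF y])
      finally have "length Cs \<le> S" by (simp add: S_def le_nat_floor)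
      moreover have t: "real t \<le> f G ?A * real (length Bs)"
        using tb inst ne Cs(1) unfolding run_time_bound_def by blast
      have f0: "0 \<le> f G ?A"
        using order_trans[OF of_nat_0_le_iff t] ne by (simp add: zero_le_mult_iff)
      have "f G ?A \<le> real F"
        using layout_max_ge[OF y, of f G] real_nat_ceiling_ge[of ?f] unfolding F_def by linarith
      then have "real t \<le> real F * real (length Bs)"
        using t by (meson mult_right_mono of_nat_0_le_iff order_trans)
      then have "t \<le> F * length Bs"
        by (metis of_nat_le_iff of_nat_mult)
      then have "calls ?\<Gamma> (snd R) (reduce_input k G ?A Bs) (enc_family ?n Cs) (F * length Bs)"
        by (rule calls_of_runs[OF Cs(1)])
      \<comment> \<open>The routine compares \<open>Cs\<close> with its input, and
        \<open>dom\<close> compares that input with all tuples.\<close>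
      moreover have "dominates k \<P> G ?A (set Cs) (tuples k ?A)"
        using represents_dominates[OF Cs(4,3)] dom by (blast intro: dominates_trans)
      moreover have "set Cs \<subseteq> tuples k ?A"
        using Cs(3) inst by (auto simp: reduce_instance_def)
      ultimately show ?thesis
        using Cs(2) f0 by (auto simp: good_family_def)
    qed
    obtain Cs where Cs: "calls ?\<Gamma> (?b + 21) (algorithm_input k G L) (enc_family ?n Cs)
        (5000 * (2 ^ k * k * S\<^sup>2 * (?n + F)) * ?n + 4100 * ?n ^ 3)" "good_family k \<P> G S (verts G) Cs"
      using layout_program_correct[where R = R and F = F, OF _ G L k S(1)] run by blast
    then obtain t where t: "runs (?\<Gamma>, ?b + 21) (algorithm_input k G L) (enc_family ?n Cs) t"
        "t \<le> 5000 * (2 ^ k * k * S\<^sup>2 * (?n + F)) * ?n + 4100 * ?n ^ 3"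
      by (auto simp: calls_def)
    have n: "1 \<le> real ?n"
    proof -
      have "verts G \<noteq> {}"
        using L leaves_nonempty[of L] by (auto simp: rooted_layout_def)
      then show ?thesis by (auto simp: verts_def)
    qed
    \<comment> \<open>No sign of \<open>f\<close> is assumed. The run on all tuples at the root, a
      nonempty family, takes nonnegative time and so forces a nonnegative value there.\<close>
    have f0: "0 \<le> ?f"
    proof -
      let ?A = "set (leaves L)"
      have A: "?A = verts G" using L by (simp add: rooted_layout_def)
      obtain Bs where Bs: "set Bs = tuples k ?A" "distinct Bs"
        using finite_distinct_list finite_tuples[of ?A k] by blast
      have "replicate k {} \<in> tuples k ?A" by (rule tuplesI) auto
      then have "Bs \<noteq> []" using Bs(1) by auto
      moreover have "reduce_instance k G ?A Bs"
        using G A Bs by (simp add: reduce_instance_def)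
      moreover have "dominates k \<P> G ?A (set Bs) (tuples k ?A)"
        unfolding Bs(1) dominates_def by auto
      ultimately have "0 \<le> f G ?A" using run[OF subtrees_self] by blast
      then show ?thesis using layout_max_ge[OF subtrees_self, of f G L] by linarith
    qed
    have time: "real t \<le> 10000 * (2 ^ (2 * k) * real k * ?s\<^sup>2 * (?f * real ?n + real ?n ^ 2) + real ?n ^ 3)"
    proof -
      have lin: "u \<le> 10000 * (a * b + c)" if "x \<le> a * (2 * b)" "u \<le> 5000 * x + 4100 * c" "0 \<le> c"
        for u a b c x :: real
        using that by (simp add: algebra_simps)
      have F: "real F \<le> ?f + 1" using f0 unfolding F_def by linarith
      have "(real ?n + real F) * real ?n \<le> (real ?n + (?f + 1)) * real ?n"
        using F n by (intro mult_right_mono) auto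
      also have "\<dots> = real ?n * real ?n + ?f * real ?n + real ?n"
        by (simp add: algebra_simps)
      also have "\<dots> \<le> 2 * (?f * real ?n + real ?n ^ 2)"
        using mult_left_mono[OF n of_nat_0_le_iff[of ?n]] mult_nonneg_nonneg[OF f0 of_nat_0_le_iff[of ?n]]
        unfolding power2_eq_square distrib_left by linarith
      finally have nF: "(real ?n + real F) * real ?n \<le> 2 * (?f * real ?n + real ?n ^ 2)" .
      \<comment> \<open>The families of \<open>2^k\<close> tuples at the leaves are the only source
        of an exponential factor; it is weakened here to the claimed one.\<close>
      have "2 ^ k * real k * (real S)\<^sup>2 \<le> 2 ^ (2 * k) * real k * ?s\<^sup>2"
        using S(2) s1 by (intro mult_mono power_mono power_increasing) auto
      then have "2 ^ k * real k * (real S)\<^sup>2 * ((real ?n + real F) * real ?n)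
          \<le> 2 ^ (2 * k) * real k * ?s\<^sup>2 * (2 * (?f * real ?n + real ?n ^ 2))"
        by (rule mult_mono[OF _ nF]) auto
      moreover have "real t \<le> 5000 * (2 ^ k * real k * (real S)\<^sup>2 * ((real ?n + real F) * real ?n)) + 4100 * real ?n ^ 3"
        using of_nat_mono[OF t(2), where 'a = real] by (simp add: mult.assoc)
      moreover have "0 \<le> real ?n ^ 3" by simp
      ultimately show ?thesis by (rule lin)
    qed
    have good: "distinct Cs" "set Cs \<subseteq> tuples k (verts G)" "length Cs \<le> S"
        "dominates k \<P> G (verts G) (set Cs) (tuples k (verts G))"
      using Cs(2) by (auto simp: good_family_def)
    have "real (length Cs) \<le> ?s" using good(3) S(2) by linarith
    moreover have "\<P> G \<noteq> {} \<longrightarrow> (\<exists>B \<in> set Cs. optimal_solution \<P> G B)"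
      using dominates_optimal[OF good(4,2)] kp G by (auto simp: k_problem_def)
    ultimately show "\<exists>Bs t. runs (?\<Gamma>, ?b + 21) (algorithm_input k G L) (enc_family ?n Bs) t \<and>
          real t \<le> 10000 * (2 ^ (2 * k) * real k * ?s\<^sup>2 * (?f * real ?n + real ?n ^ 2) + real ?n ^ 3) \<and>
          distinct Bs \<and> set Bs \<subseteq> tuples k (verts G) \<and> real (length Bs) \<le> ?s \<and>
          (\<P> G \<noteq> {} \<longrightarrow> (\<exists>B \<in> set Bs. optimal_solution \<P> G B))"
      using t(1) time good(1,2) by blast
  qed
qed

end
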